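(* Let $X$ be a non-singleton connected, locally connected, locally compact Hausdorff space with no cut points and such that the Aleksandrov one-point compactification of $X$ has genus $0$. Then $p\mathbf{TM}(X)$ is dense in $\mathbf{TM}(X)$, and $p\mathbf{DTM}(X)$ is dense in $\mathbf{DTM}(X)$.
   Context: A cut point of a connected space $X$ is a point $x$ with $X\setminus\{x\}$ not connected. In a compact space $Y$ a set is solid if it and its complement are both connected. A compact (connected, locally connected, Hausdorff) space $Y$ has genus $0$ iff any finite union of pairwise disjoint closed solid subsets of $Y$ has a connected complement. If $X$ is already compact, the one-point compactification is understood to be $X$ itself. $\mathcal{O}(X)$, $\mathcal{C}(X)$, $\mathcal{K}(X)$ are the collections of open, closed, compact subsets of $X$. A deficient topological measure on $X$ is a set function $\nu:\mathcal{C}(X)\cup\mathcal{O}(X)\to[0,\infty]$, not identically $\infty$, such that: (DTM1) $\nu(C\sqcup K)=\nu(C)+\nu(K)$ for disjoint $C,K\in\mathcal{K}(X)$; (DTM2) $\nu(U)=\sup\{\nu(C): C\subseteq U,\ C\in\mathcal{K}(X)\}$ for $U\in\mathcal{O}(X)$; (DTM3) $\nu(F)=\inf\{\nu(U): F\subseteq U,\ U\in\mathcal{O}(X)\}$ for $F\in\mathcal{C}(X)$. A topological measure is a set function $\mu:\mathcal{C}(X)\cup\mathcal{O}(X)\to[0,\infty]$, not identically $\infty$, satisfying (DTM2), (DTM3) and: if $A,B,A\sqcup B\in\mathcal{K}(X)\cup\mathcal{O}(X)$ (disjoint union) then $\mu(A\sqcup B)=\mu(A)+\mu(B)$. $\mathbf{DTM}(X)$,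 $\mathbf{TM}(X)$ are the sets of finite ($\mu(X)<\infty$) deficient topological measures and finite topological measures. A deficient topological measure $\nu$ is proper if $m\le\nu$ (on $\mathcal{O}(X)\cup\mathcal{C}(X)$) with $m$ a Radon measure implies $m=0$; here a Radon measure is a Borel measure finite on compact sets, outer regular on all Borel sets and inner regular (by compact sets) on open sets. $p\mathbf{DTM}(X)$ and $p\mathbf{TM}(X)$ are the sets of proper elements of $\mathbf{DTM}(X)$ and $\mathbf{TM}(X)$. $\mathbf{DTM}(X)$ carries the weak topology: the coarsest topology making $\mu\mapsto\int_X f\,d\mu$ continuous for every $f\in C_0^+(X)$ (nonnegative continuous functions vanishing at infinity), where $\int_X f\,d\mu=\int_0^b\mu(f^{-1}((t,\infty)))\,dt$ if $f(X)\subseteq[0,b]$. "$Y$ is dense in $Z$" means $Z\subseteq\overline{Y}$. *)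

theory Defs
  imports "HOL-Analysis.Analysis"
begin

definition cut_point :: "'a topology \<Rightarrow> 'a \<Rightarrow> bool" where
  "cut_point X x \<longleftrightarrow> x \<in> topspace X \<and> \<not> connectedin X (topspace X - {x})"

definition solid_in :: "'a topology \<Rightarrow> 'a set \<Rightarrow> bool" where
  "solid_in Y S \<longleftrightarrow> connectedin Y S \<and> connectedin Y (topspace Y - S)"

text \<open>The notion is meant for compact, connected, locally connected Hausdorff spaces \<open>Y\<close>.\<close>

definition genus_zero :: "'a topology \<Rightarrow> bool" where
  "genus_zero Y \<longleftrightarrow>
     (\<forall>\<F>. finite \<F> \<and> pairwise disjnt \<F> \<and> (\<forall>C\<in>\<F>. closedin Y C \<and> solid_in Y C)
          \<longrightarrow> connectedin Y (topspace Y - \<Union>\<F>))"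

text \<open>The constant \<open>Alexandroff_compactification\<close> adds an isolated point to a compact space, whereas
  here the one-point compactification of a compact space is the space itself. The two
  cases live on different types, hence a case distinction inside the predicate.\<close>

definition one_point_compactification_genus_zero :: "'a topology \<Rightarrow> bool" where
  "one_point_compactification_genus_zero X \<longleftrightarrow>
     (if compact_space X then genus_zero X else genus_zero (Alexandroff_compactification X))"

definition open_or_closed_sets :: "'a topology \<Rightarrow> 'a set set" where
  "open_or_closed_sets X = {U. openin X U} \<union> {C. closedin X C}"

definition inner_regular_on_open :: "'a topology \<Rightarrow> ('a set \<Rightarrow> ennreal) \<Rightarrow> bool" where
  "inner_regular_on_open X \<nu> \<longleftrightarrow>
     (\<forall>U. openin X U \<longrightarrow> \<nu> U = (SUP C\<in>{C. compactin X C \<and> C \<subseteq> U}. \<nu> C))"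

definition outer_regular_on_closed :: "'a topology \<Rightarrow> ('a set \<Rightarrow> ennreal) \<Rightarrow> bool" where
  "outer_regular_on_closed X \<nu> \<longleftrightarrow>
     (\<forall>F. closedin X F \<longrightarrow> \<nu> F = (INF U\<in>{U. openin X U \<and> F \<subseteq> U}. \<nu> U))"

text \<open>Set functions with domain \<open>open_or_closed_sets X\<close> are represented by functions on all sets
  that are \<open>undefined\<close> outside this domain.\<close>

definition deficient_topological_measure :: "'a topology \<Rightarrow> ('a set \<Rightarrow> ennreal) \<Rightarrow> bool" where
  "deficient_topological_measure X \<nu> \<longleftrightarrow>
     \<nu> \<in> extensional (open_or_closed_sets X) \<and>
     (\<exists>A\<in>open_or_closed_sets X. \<nu> A \<noteq> \<infinity>) \<and>
     (\<forall>C K. compactin X C \<and> compactin X K \<and> disjnt C K \<longrightarrow> \<nu> (C \<union> K) = \<nu> C + \<nu> K) \<and>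
     inner_regular_on_open X \<nu> \<and>
     outer_regular_on_closed X \<nu>"

definition topological_measure :: "'a topology \<Rightarrow> ('a set \<Rightarrow> ennreal) \<Rightarrow> bool" where
  "topological_measure X \<mu> \<longleftrightarrow>
     \<mu> \<in> extensional (open_or_closed_sets X) \<and>
     (\<exists>A\<in>open_or_closed_sets X. \<mu> A \<noteq> \<infinity>) \<and>
     (\<forall>A B. (\<forall>D\<in>{A, B, A \<union> B}. compactin X D \<or> openin X D) \<and> disjnt A B
            \<longrightarrow> \<mu> (A \<union> B) = \<mu> A + \<mu> B) \<and>
     inner_regular_on_open X \<mu> \<and>
     outer_regular_on_closed X \<mu>"

definition DTM :: "'a topology \<Rightarrow> ('a set \<Rightarrow> ennreal) set" where
  "DTM X = {\<nu>. deficient_topological_measure X \<nu> \<and> \<nu> (topspace X) < \<infinity>}"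

definition TM :: "'a topology \<Rightarrow> ('a set \<Rightarrow> ennreal) set" where
  "TM X = {\<mu>. topological_measure X \<mu> \<and> \<mu> (topspace X) < \<infinity>}"

definition radon_measure :: "'a topology \<Rightarrow> 'a measure \<Rightarrow> bool" where
  "radon_measure X m \<longleftrightarrow>
     sets m = sets (sigma (topspace X) {U. openin X U}) \<and>
     (\<forall>K. compactin X K \<longrightarrow> emeasure m K < \<infinity>) \<and>
     (\<forall>B\<in>sets m. emeasure m B = (INF U\<in>{U. openin X U \<and> B \<subseteq> U}. emeasure m U)) \<and>
     (\<forall>U. openin X U \<longrightarrow> emeasure m U = (SUP K\<in>{K. compactin X K \<and> K \<subseteq> U}. emeasure m K))"

definition proper_dtm :: "'a topology \<Rightarrow> ('a set \<Rightarrow> ennreal) \<Rightarrow> bool" where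
  "proper_dtm X \<nu> \<longleftrightarrow>
     (\<forall>m. radon_measure X m \<and> (\<forall>A\<in>open_or_closed_sets X. emeasure m A \<le> \<nu> A)
          \<longrightarrow> (\<forall>A\<in>sets m. emeasure m A = 0))"

definition pDTM :: "'a topology \<Rightarrow> ('a set \<Rightarrow> ennreal) set" where
  "pDTM X = {\<nu> \<in> DTM X. proper_dtm X \<nu>}"

definition pTM :: "'a topology \<Rightarrow> ('a set \<Rightarrow> ennreal) set" where
  "pTM X = {\<mu> \<in> TM X. proper_dtm X \<mu>}"

definition C0_nonneg :: "'a topology \<Rightarrow> ('a \<Rightarrow> real) set" where
  "C0_nonneg X =
     {f. continuous_map X euclideanreal f \<and> (\<forall>x\<in>topspace X. 0 \<le> f x) \<and>
         (\<forall>\<epsilon>>0. compactin X {x \<in> topspace X. f x \<ge> \<epsilon>})}"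

text \<open>For finite \<open>\<mu>\<close> and \<open>f\<close> with values in \<open>[0,b]\<close> this is the integral over \<open>[0,b]\<close> of
  \<open>t \<mapsto> \<mu> (f\<^sup>-\<^sup>1 (t,\<infinity>))\<close>, where the least possible \<open>b\<close> is taken;
  see \<open>dtm_integral_eq\<close> below for the independence of \<open>b\<close>.\<close>

definition dtm_integral :: "'a topology \<Rightarrow> ('a set \<Rightarrow> ennreal) \<Rightarrow> ('a \<Rightarrow> real) \<Rightarrow> real" where
  "dtm_integral X \<mu> f =
     integral {0..(SUP x\<in>topspace X. f x)} (\<lambda>t. enn2real (\<mu> {x \<in> topspace X. t < f x}))"

definition weak_topology :: "'a topology \<Rightarrow> ('a set \<Rightarrow> ennreal) topology" where
  "weak_topology X =
     topology_generated_by
       {{\<mu> \<in> DTM X. dtm_integral X \<mu> f \<in> V} | f V. f \<in> C0_nonneg X \<and> open V}"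

lemma TM_subset_DTM: "TM X \<subseteq> DTM X"
proof
  fix \<mu> assume \<mu>: "\<mu> \<in> TM X"
  have "\<mu> (C \<union> K) = \<mu> C + \<mu> K" if "compactin X C" "compactin X K" "disjnt C K" for C K
  proof -
    have "\<forall>D\<in>{C, K, C \<union> K}. compactin X D \<or> openin X D"
      using that compactin_Un[of X C K] by simp
    with \<mu> that(3) show ?thesis
      unfolding TM_def topological_measure_def by blast
  qed
  with \<mu> show "\<mu> \<in> DTM X"
    by (simp add: TM_def DTM_def topological_measure_def deficient_topological_measure_def)
qed

lemma DTM_empty:
  assumes "\<nu> \<in> DTM X"
  shows "\<nu> {} = 0"
proof -
  have "\<nu> (C \<union> K) = \<nu> C + \<nu> K" if "compactin X C" "compactin X K" "disjnt C K" for C K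
    using assms that unfolding DTM_def deficient_topological_measure_def by blast
  from this[of "{}" "{}"] have add: "\<nu> {} + \<nu> {} = \<nu> {}"
    by simp
  have "\<nu> (topspace X) = (SUP C\<in>{C. compactin X C \<and> C \<subseteq> topspace X}. \<nu> C)"
    using assms unfolding DTM_def deficient_topological_measure_def inner_regular_on_open_def
    by blast
  moreover have "\<nu> {} \<le> (SUP C\<in>{C. compactin X C \<and> C \<subseteq> topspace X}. \<nu> C)"
    by (rule SUP_upper) simp
  ultimately have "\<nu> {} \<le> \<nu> (topspace X)"
    by simp
  also have "\<dots> < \<infinity>"
    using assms by (simp add: DTM_def)
  finally have "\<nu> {} \<noteq> \<infinity>"
    by simp
  with add show ?thesis
    using ennreal_add_left_cancel[of "\<nu> {}" "\<nu> {}" 0] by simp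
qed

lemma topspace_weak_topology: "topspace (weak_topology X) = DTM X"
proof -
  have "(\<lambda>x. 0) \<in> C0_nonneg X"
    by (auto simp: C0_nonneg_def)
  then have "DTM X \<in> {{\<mu> \<in> DTM X. dtm_integral X \<mu> f \<in> V} | f V. f \<in> C0_nonneg X \<and> open V}"
    by (auto intro!: exI[of _ "\<lambda>x. 0"] exI[of _ UNIV])
  then show ?thesis
    unfolding weak_topology_def topology_generated_by_topspace by blast
qed

lemma dtm_integral_eq:
  assumes "\<mu> \<in> DTM X" and "topspace X \<noteq> {}" and "f ` topspace X \<subseteq> {0..b}"
  shows "dtm_integral X \<mu> f = integral {0..b} (\<lambda>t. enn2real (\<mu> {x \<in> topspace X. t < f x}))"
proof -
  let ?s = "SUP x\<in>topspace X. f x" and ?g = "\<lambda>t. enn2real (\<mu> {x \<in> topspace X. t < f x})"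
  have bdd: "bdd_above (f ` topspace X)"
    using assms(3) by (meson bdd_above_Icc bdd_above_mono)
  have le: "?s \<le> b"
    using assms(2,3) by (intro cSUP_least) auto
  have van: "?g t = 0" if "?s \<le> t" for t
  proof -
    have empty: "{x \<in> topspace X. t < f x} = {}"
      using cSUP_upper[OF _ bdd] that by fastforce
    show ?thesis
      unfolding empty using DTM_empty[OF assms(1)] by simp
  qed
  have "integral {0..?s} ?g = integral {0..b} (\<lambda>t. if t \<in> {0..?s} then ?g t else 0)"
  proof -
    have "{0..?s} \<inter> {0..b} = {0..?s}"
      using le by auto
    then show ?thesis
      using integral_restrict_Int[of "{0..b}" "{0..?s}" ?g] by (simp only:)
  qed
  also have "\<dots> = integral {0..b} ?g"
    using van by (intro integral_cong) auto
  finally show ?thesis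
    by (simp add: dtm_integral_def)
qed

end

theory Submission
  imports Defs
begin

text \<open>
A finite (deficient) topological measure \<open>\<nu>\<close> fails to be proper only because of the greatest Radon
measure \<open>m\<close> below it. This measure exists: it is the outer measure generated by the values of \<open>\<nu>\<close> on open
sets, and open sets are Caratheodory measurable because \<open>\<nu>\<close> is superadditive
(\<open>greatest_Radon_measure_below_DTM\<close>). The difference \<open>\<nu> - m\<close> is again a (deficient) topological
measure (\<open>DTM_diff_dominated_measure\<close>, \<open>TM_diff_dominated_measure\<close>). So it remains to replace \<open>m\<close> by
something weakly close to it that does not spoil properness.

A Radon measure is weakly close to finite combinations of point masses, and a point mass is weakly
close to a topological measure that is concentrated near the point but is null near every single point.
The latter is obtained from three distinct points in a small connected open set \<open>V\<close>. Call a compact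
connected set a separator if no connected set disjoint from it contains two of the three points, and
give an open set the value 1 if it contains a separator and 0 otherwise. Any two separators intersect
(\<open>disjoint_separators_False\<close>). In a compact space of genus 0, if a closed set has a neighbourhood
without separators, then its complement contains one (\<open>complement_contains_separator\<close>). These two facts
say that of a closed set and its complement exactly one has the value 1, which makes the set
function a topological measure. It is null near every point because there are no cut points: some
separator avoids a given point, and hence a neighbourhood of it. Separators are sought in the
one-point compactification, which inherits local connectedness from the space
(\<open>locally_connected_Alexandroff_compactification\<close>).

If \<open>\<kappa>\<close> is a finite combination of such three-point measures, then \<open>\<nu> - m + \<kappa>\<close> is proper: a Radon measure
\<open>r\<close> below it satisfies \<open>r + m \<le> \<nu>\<close> on sets where \<open>\<kappa>\<close> vanishes, and these sets are large enough to give
\<open>r + m \<le> \<nu>\<close> on all open sets, so that \<open>r = 0\<close> since \<open>m\<close> is the greatest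
(\<open>proper_dtm_replace_greatest_Radon_measure\<close>). Finally, choose the connected open sets so small that
finitely many given functions oscillate on them by less than \<open>\<delta>\<close>, and let the coefficients of \<open>\<kappa>\<close> be the
\<open>m\<close>-masses of disjoint Borel pieces of these sets. On superlevel sets of the given functions the new
set function then agrees with \<open>\<nu>\<close> up to a shift of the level by \<open>\<delta>\<close>, so the integrals differ by at most
\<open>\<delta>\<close> times the total mass (\<open>dtm_integral_close\<close>). The same construction serves topological measures
and deficient topological measures.
\<close>

section \<open>Connected sets in locally connected spaces\<close>

lemma locally_connected_spaceE:
  assumes "locally_connected_space X" "openin X W" "x \<in> W"
  obtains V where "openin X V" "connectedin X V" "x \<in> V" "V \<subseteq> W"
  using assms unfolding locally_connected_space by blast

text \<open>The points of \<open>W\<close> that can be joined to a fixed point by a compact connected subset of \<open>W\<close> form a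
clopen subset of \<open>W\<close>, hence all of \<open>W\<close>; finitely many such connecting sets absorb a given compact set.
All separating sets below are produced in this way.\<close>

lemma compact_connected_hull_in_connected_open:
  assumes X: "locally_connected_space X" "locally_compact_space X" "Hausdorff_space X"
    and W: "openin X W" "connectedin X W"
    and C: "compactin X C" "C \<subseteq> W"
  obtains D where "compactin X D" "connectedin X D" "C \<subseteq> D" "D \<subseteq> W"
proof (cases "W = {}")
  case True
  with C that[of "{}"] show ?thesis by simp
next
  case False
  then obtain p where p: "p \<in> W" by blast
  have loc: "\<exists>V B. openin X V \<and> compactin X B \<and> connectedin X B \<and> x \<in> V \<and> V \<subseteq> B \<and> B \<subseteq> W"
    if x: "x \<in> W" for x
  proof -
    obtain U K where UK: "openin X U" "compactin X K" "x \<in> U" "U \<subseteq> K" "K \<subseteq> W"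
      using X W(1) x locally_compact_space_neighbourhood_base[of X]
      unfolding neighbourhood_base_of by metis
    obtain V where V: "openin X V" "connectedin X V" "x \<in> V" "V \<subseteq> U"
      using locally_connected_spaceE[OF X(1) UK(1,3)] .
    have "X closure_of V \<subseteq> K"
      using UK V X(3) by (meson closure_of_minimal compactin_imp_closedin order_trans)
    moreover have "compactin X (X closure_of V)"
      using UK(2) calculation by (meson closed_compactin closedin_closure_of)
    ultimately show ?thesis
      using V UK by (meson closure_of_subset connectedin_closure_of openin_subset order_trans)
  qed
  define R where "R = {x. \<exists>D. compactin X D \<and> connectedin X D \<and> p \<in> D \<and> x \<in> D \<and> D \<subseteq> W}"
  have step: "x \<in> R \<Longrightarrow> \<exists>V D. openin X V \<and> x \<in> V \<and> compactin X D \<and> connectedin X D \<and> p \<in> D \<and> V \<subseteq> D \<and> D \<subseteq> W"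
    for x
  proof -
    assume "x \<in> R"
    then obtain D where D: "compactin X D" "connectedin X D" "p \<in> D" "x \<in> D" "D \<subseteq> W"
      unfolding R_def by blast
    obtain V B where "openin X V" "compactin X B" "connectedin X B" "x \<in> V" "V \<subseteq> B" "B \<subseteq> W"
      using loc[of x] D by (metis subsetD)
    with D show ?thesis
      using connectedin_Un[of X D B] compactin_Un[of X D B]
      by (intro exI[of _ V] exI[of _ "D \<union> B"]) auto
  qed
  have "openin X R"
    unfolding openin_subopen[of X R]
  proof
    fix x assume "x \<in> R"
    from step[OF this] obtain V D where
      "openin X V" "x \<in> V" "compactin X D" "connectedin X D" "p \<in> D" "V \<subseteq> D" "D \<subseteq> W" by blast
    then show "\<exists>T. openin X T \<and> x \<in> T \<and> T \<subseteq> R"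
      unfolding R_def by (intro exI[of _ V]) blast
  qed
  moreover have "openin X (W - R)"
    unfolding openin_subopen[of X "W - R"]
  proof
    fix x assume x: "x \<in> W - R"
    then obtain V B where VB: "openin X V" "compactin X B" "connectedin X B" "x \<in> V" "V \<subseteq> B" "B \<subseteq> W"
      using loc[of x] by (metis DiffD1)
    have "y \<notin> R" if y: "y \<in> V" for y
    proof
      assume "y \<in> R"
      then obtain D where D: "compactin X D" "connectedin X D" "p \<in> D" "y \<in> D" "D \<subseteq> W"
        unfolding R_def by blast
      have "compactin X (D \<union> B) \<and> connectedin X (D \<union> B) \<and> p \<in> D \<union> B \<and> x \<in> D \<union> B \<and> D \<union> B \<subseteq> W"
        using D VB y connectedin_Un[of X D B] compactin_Un[of X D B] by blast
      then have "x \<in> R" unfolding R_def by blast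
      with x show False by blast
    qed
    with VB show "\<exists>T. openin X T \<and> x \<in> T \<and> T \<subseteq> W - R"
      by (intro exI[of _ V]) blast
  qed
  moreover have "p \<in> R"
    unfolding R_def using p openin_subset[OF W(1)] by (auto intro!: exI[of _ "{p}"])
  moreover have "R \<subseteq> W" unfolding R_def by blast
  ultimately have "W \<subseteq> R"
    using W(2) p unfolding connectedin by blast
  then have "\<forall>x\<in>C. \<exists>V D. openin X V \<and> x \<in> V \<and> compactin X D \<and> connectedin X D \<and> p \<in> D \<and> V \<subseteq> D \<and> D \<subseteq> W"
    using step C(2) by blast
  then obtain V D where VD: "\<And>x. x \<in> C \<Longrightarrow> openin X (V x) \<and> x \<in> V x \<and> compactin X (D x) \<and>
      connectedin X (D x) \<and> p \<in> D x \<and> V x \<subseteq> D x \<and> D x \<subseteq> W"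
    by metis
  have "\<forall>U\<in>V ` C. openin X U" "C \<subseteq> \<Union>(V ` C)" using VD by blast+
  then obtain F where F: "finite F" "F \<subseteq> V ` C" "C \<subseteq> \<Union>F"
    using compactinD[OF C(1)] by metis
  then obtain I where I: "finite I" "I \<subseteq> C" "F = V ` I"
    by (meson finite_subset_image)
  show ?thesis
  proof
    show "connectedin X (\<Union>(insert {p} (D ` I)))"
      using VD I p openin_subset[OF W(1)] by (intro connectedin_Union) auto
    show "compactin X (\<Union>(insert {p} (D ` I)))"
      using VD I p openin_subset[OF W(1)] by (intro compactin_Union) auto
    show "C \<subseteq> \<Union>(insert {p} (D ` I))"
    proof
      fix x assume "x \<in> C"
      then obtain i where i: "i \<in> I" "x \<in> V i" using F(3) I(3) by blast
      then show "x \<in> \<Union>(insert {p} (D ` I))" using VD[of i] I(2) by auto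
    qed
    have "D i \<subseteq> W" if "i \<in> I" for i using VD[of i] I(2) that by blast
    then show "\<Union>(insert {p} (D ` I)) \<subseteq> W" using p by auto
  qed
qed

text \<open>Suppose the complement of \<open>V\<close> splits into two closed pieces, and let \<open>B\<close> be the piece that misses the
connected set \<open>D\<close>. Then \<open>B\<close> is a union of components of the complement of \<open>D\<close>, which are open by local
connectedness. So \<open>B\<close> is clopen in \<open>Y\<close>, hence empty.\<close>

lemma connectedin_complement_of_component:
  assumes Y: "connected_space Y" "locally_connected_space Y"
    and D: "closedin Y D" "connectedin Y D" "D \<noteq> {}"
    and V: "V \<in> connected_components_of (subtopology Y (topspace Y - D))"
  shows "connectedin Y (topspace Y - V)"
proof -
  let ?Z = "subtopology Y (topspace Y - D)"
  have opn: "openin Y W" if "W \<in> connected_components_of ?Z" for W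
    using Y(2) D(1) that unfolding locally_connected_space_open_connected_components
    by blast
  have VD: "V \<inter> D = {}"
    using connected_components_of_subset[OF V] by auto
  have key: "B = {}" if AB: "closedin Y A" "closedin Y B" "A \<inter> B = {}" "A \<union> B = topspace Y - V" "D \<subseteq> A" for A B
  proof -
    have "openin Y B"
      unfolding openin_subopen[of Y B]
    proof
      fix x assume x: "x \<in> B"
      then have xZ: "x \<in> topspace ?Z" using AB closedin_subset by fastforce
      then obtain W where W: "W \<in> connected_components_of ?Z" "x \<in> W"
        using Union_connected_components_of[of ?Z] by (metis UnionE)
      have "connectedin Y W" 
        using connectedin_connected_components_of[OF W(1)] by (simp add: connectedin_subtopology)
      moreover have "W \<noteq> V" using x AB W by auto
      then have "W \<inter> V = {}"
        using pairwise_disjoint_connected_components_of[of ?Z] W V unfolding pairwise_def disjnt_def by blast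
      then have "W \<subseteq> A \<union> B" 
        using AB openin_subset[OF opn[OF W(1)]] by blast
      ultimately have "W \<inter> A = {}"
        using AB x W unfolding connectedin_closedin by blast
      with \<open>W \<subseteq> A \<union> B\<close> show "\<exists>T. openin Y T \<and> x \<in> T \<and> T \<subseteq> B"
        using opn[OF W(1)] W by (intro exI[of _ W]) blast
    qed
    then have "B = {} \<or> B = topspace Y"
      using Y(1) AB(2) by (simp add: connected_space_clopen_in)
    moreover have "B \<noteq> topspace Y"
      using AB D by (metis closedin_subset inf.orderE inf_bot_right subset_empty inf_commute)
    ultimately show ?thesis by blast
  qed
  have cl: "closedin Y (topspace Y - V)"
    using opn[OF V] by blast
  have "False" if AB: "closedin Y A" "closedin Y B" "topspace Y - V \<subseteq> A \<union> B" "A \<inter> B \<inter> (topspace Y - V) = {}"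
     "A \<inter> (topspace Y - V) \<noteq> {}" "B \<inter> (topspace Y - V) \<noteq> {}" for A B
  proof -
    let ?A = "A \<inter> (topspace Y - V)" and ?B = "B \<inter> (topspace Y - V)"
    have c: "closedin Y ?A" "closedin Y ?B" "?A \<inter> ?B = {}" "?A \<union> ?B = topspace Y - V"
      using AB cl by (auto simp: closedin_Int)
    have "D \<subseteq> ?A \<union> ?B" using c(4) VD closedin_subset[OF D(1)] by blast
    then have "D \<inter> ?A = {} \<or> D \<inter> ?B = {}" using D(2) c
      unfolding connectedin_closedin by blast
    then have "D \<subseteq> ?A \<or> D \<subseteq> ?B" using \<open>D \<subseteq> ?A \<union> ?B\<close> by blast
    then show False
    proof
      assume "D \<subseteq> ?A"
      from key[OF c this] AB show False by simp
    next
      assume "D \<subseteq> ?B"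
      from key[of ?B ?A, OF c(2) c(1) _ _ this] c AB show False by (simp add: Int_ac Un_ac)
    qed
  qed
  then show ?thesis unfolding connectedin_closedin by blast
qed

text \<open>Only the point at infinity is in question. Let \<open>C\<close> be compact and \<open>N\<close> a relatively compact open
neighbourhood of \<open>C\<close>. As \<open>X\<close> is connected, every component of \<open>X - C\<close> that leaves \<open>N\<close> meets the
compact frontier of \<open>N\<close> (or is all of \<open>X\<close>), so all but finitely many components lie in \<open>N\<close>. Hence the
components with noncompact closure fill a neighbourhood of infinity, and each of them has infinity in
its closure, so that it stays connected when the point at infinity is added to it.\<close>

lemma locally_connected_Alexandroff_compactification:
  assumes X: "connected_space X" "locally_connected_space X" "locally_compact_space X" "Hausdorff_space X"
    and nc: "\<not> compact_space X"
  shows "locally_connected_space (Alexandroff_compactification X)"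
  unfolding locally_connected_space_im_kleinen
proof clarify
  let ?Y = "Alexandroff_compactification X"
  fix V x
  assume V: "openin ?Y V" and xV: "x \<in> V"
  show "\<exists>U. openin ?Y U \<and> x \<in> U \<and> U \<subseteq> V \<and> (\<forall>y\<in>U. \<exists>C. connectedin ?Y C \<and> C \<subseteq> V \<and> x \<in> C \<and> y \<in> C)"
  proof (cases x)
    case (Some a)
    have "openin X {z \<in> topspace X. Some z \<in> V}"
      using V continuous_map_Some openin_continuous_map_preimage by blast
    moreover have "a \<in> {z \<in> topspace X. Some z \<in> V}"
      using xV openin_subset[OF V] Some by auto
    ultimately obtain U where U: "openin X U" "connectedin X U" "a \<in> U" "U \<subseteq> {z \<in> topspace X. Some z \<in> V}"
      by (rule locally_connected_spaceE[OF X(2)])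
    show ?thesis
      using U Some connectedin_continuous_map_image[OF continuous_map_Some U(2)]
      by (intro exI[of _ "Some ` U"]) auto
  next
    case None
    then obtain C where C: "compactin X C" "closedin X C" "V = insert None (Some ` (topspace X - C))"
      using V xV by (auto simp: openin_Alexandroff_compactification)
    obtain N K where NK: "openin X N" "compactin X K" "closedin X K" "C \<subseteq> N" "N \<subseteq> K"
      using X(3,4) C(1,2) locally_compact_space_compact_closed_compact[of X] by metis
    let ?Z = "subtopology X (topspace X - C)"
    let ?CC = "connected_components_of ?Z"
    have opn: "openin X W" if "W \<in> ?CC" for W
      using X(2) C(2) that unfolding locally_connected_space_open_connected_components by blast
    have conn: "connectedin X W" if "W \<in> ?CC" for W
      using connectedin_connected_components_of[OF that] by (simp add: connectedin_subtopology)
    have cls: "X closure_of W \<subseteq> W \<union> C" if "W \<in> ?CC" for W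
    proof -
      have "topspace X - (W \<union> C) = \<Union>(?CC - {W})"
        using complement_connected_components_of_Union[OF that] by auto
      moreover have "openin X (\<Union>(?CC - {W}))" using opn by blast
      moreover have "W \<union> C \<subseteq> topspace X" 
        using openin_subset[OF opn[OF that]] closedin_subset[OF C(2)] by blast
      ultimately have "closedin X (W \<union> C)" by (simp add: closedin_def)
      then show ?thesis by (simp add: closure_of_minimal)
    qed
    let ?F = "X frontier_of N"
    have Fcomp: "compactin X ?F"
    proof -
      have "?F \<subseteq> K" using NK by (metis Diff_subset closure_of_minimal frontier_of_def order_trans)
      then show ?thesis using NK(2) closed_compactin closedin_frontier_of by blast
    qed
    have FN: "?F \<inter> N = {}" using NK(1) by (simp add: frontier_of_def interior_of_openin) blast
    (* Finitely many components meet the frontier; those with compact closure are put into B. *)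
    have "?F \<subseteq> \<Union>?CC"
      using FN NK(4) frontier_of_subset_topspace[of X N] by (auto simp: Union_connected_components_of)
    then obtain \<G> where \<G>: "finite \<G>" "\<G> \<subseteq> ?CC" "?F \<subseteq> \<Union>\<G>"
      using compactinD[OF Fcomp, of ?CC] opn by metis
    define B where "B = K \<union> \<Union>((\<lambda>W. X closure_of W) ` {W \<in> \<G>. compactin X (X closure_of W)})"
    have Bc: "compactin X B"
      unfolding B_def using NK \<G>(1) by (intro compactin_Un compactin_Union) auto
    then have Bcl: "closedin X B" using X(4) compactin_imp_closedin by blast
    define U where "U = insert None (Some ` (topspace X - B))"
    have "openin ?Y U" unfolding U_def openin_Alexandroff_compactification using Bc Bcl by blast
    moreover have "U \<subseteq> V" unfolding U_def C(3) B_def using NK by auto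
    moreover have "\<exists>S. connectedin ?Y S \<and> S \<subseteq> V \<and> None \<in> S \<and> y \<in> S" if y: "y \<in> U" for y
    proof (cases y)
      case None
      then show ?thesis using C(3) by (intro exI[of _ "{None}"]) auto
    next
      case (Some z)
      then have z: "z \<in> topspace X" "z \<notin> B" using y U_def by auto
      then have "z \<in> topspace ?Z" using NK unfolding B_def by auto
      then obtain W where W: "W \<in> ?CC" "z \<in> W"
        using Union_connected_components_of[of ?Z] by (metis UnionE)
      have noncomp: "\<not> compactin X (X closure_of W)"
      proof
        assume cW: "compactin X (X closure_of W)"
        have zN: "z \<notin> N" using z NK unfolding B_def by auto
        show False
        proof (cases "W \<inter> N = {}")
          case True
          then have "N \<inter> X closure_of W = {}"
            using openin_Int_closure_of_eq_empty[OF NK(1)] by (simp add: Int_commute)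
          then have "X closure_of W \<subseteq> W" using cls[OF W(1)] NK(4) by blast
          then have "closedin X W"
            using closure_of_subset_eq[of W X] openin_subset[OF opn[OF W(1)]] by simp
          then have "W = topspace X"
            using X(1) opn[OF W(1)] W(2) by (auto simp: connected_space_clopen_in)
          then show False using cW nc by (simp add: compact_space_def)
        next
          case False
          then have "W \<inter> ?F \<noteq> {}"
            using connectedin_Int_frontier_of[OF conn[OF W(1)]] zN W(2) by blast
          then obtain W' where "W' \<in> \<G>" "W \<inter> W' \<noteq> {}" using \<G> by blast
          then have "W' = W"
            using pairwiseD[OF pairwise_disjoint_connected_components_of[of ?Z] W(1), of W'] \<G>(2)
            unfolding disjnt_def by (metis subsetD)
          with \<open>W' \<in> \<G>\<close> have "X closure_of W \<subseteq> B" unfolding B_def using cW by auto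
          then show False using z W closure_of_subset[OF openin_subset[OF opn[OF W(1)]]] by blast
        qed
      qed
      have "None \<in> ?Y closure_of (Some ` W)"
        unfolding in_closure_of
      proof (intro conjI allI impI)
        fix T assume T: "None \<in> T \<and> openin ?Y T"
        then obtain C' where C': "compactin X C'" "closedin X C'" "T = insert None (Some ` (topspace X - C'))"
          by (auto simp: openin_Alexandroff_compactification)
        have "\<not> W \<subseteq> C'"
          using noncomp C' by (meson closed_compactin closedin_closure_of closure_of_minimal)
        then show "\<exists>y. y \<in> Some ` W \<and> y \<in> T"
          using C'(3) openin_subset[OF opn[OF W(1)]] by blast
      qed simp
      moreover have "connectedin ?Y (Some ` W)"
        using connectedin_continuous_map_image[OF continuous_map_Some conn[OF W(1)]] .
      ultimately have "connectedin ?Y (insert None (Some ` W))"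
        using connectedin_intermediate_closure_of[of ?Y "Some ` W" "insert None (Some ` W)"]
          closure_of_subset[of "Some ` W" ?Y] connectedin_subset_topspace[of ?Y "Some ` W"] by blast
      moreover have "W \<subseteq> topspace X - C" using connected_components_of_subset[OF W(1)] by auto
      ultimately show ?thesis using W(2) Some C(3) by (intro exI[of _ "insert None (Some ` W)"]) auto
    qed
    ultimately show ?thesis using None by (intro exI[of _ U]) (auto simp: U_def)
  qed
qed

section \<open>Separating three points in a space of genus 0\<close>

definition separates_points :: "'b topology \<Rightarrow> 'b set \<Rightarrow> 'b set \<Rightarrow> bool" where
  "separates_points Y P D \<longleftrightarrow>
     (\<forall>S. connectedin Y S \<and> S \<inter> D = {} \<longrightarrow> (\<forall>x\<in>S \<inter> P. \<forall>y\<in>S \<inter> P. x = y))"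

text \<open>The three-point measure will give the value 1 exactly to those open sets that contain a separator.\<close>

definition contains_separator :: "'b topology \<Rightarrow> 'b set \<Rightarrow> 'b set \<Rightarrow> bool" where
  "contains_separator Y P U \<longleftrightarrow>
     (\<exists>D. compactin Y D \<and> connectedin Y D \<and> separates_points Y P D \<and> D \<subseteq> U)"

lemma contains_separator_mono:
  "contains_separator Y P U \<Longrightarrow> U \<subseteq> V \<Longrightarrow> contains_separator Y P V"
  unfolding contains_separator_def by (meson order_trans)

lemma complement_componentE:
  assumes Y: "connected_space Y" "locally_connected_space Y"
    and D: "closedin Y D" "connectedin Y D" "D \<noteq> {}"
    and x: "x \<in> topspace Y - D"
  obtains V where "openin Y V" "connectedin Y V" "connectedin Y (topspace Y - V)" "x \<in> V" "V \<inter> D = {}"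
    "\<And>S. connectedin Y S \<Longrightarrow> S \<inter> D = {} \<Longrightarrow> S \<inter> V \<noteq> {} \<Longrightarrow> S \<subseteq> V"
proof -
  let ?Z = "subtopology Y (topspace Y - D)"
  have "x \<in> \<Union>(connected_components_of ?Z)"
    using x by (simp add: Union_connected_components_of)
  then obtain V where V: "V \<in> connected_components_of ?Z" "x \<in> V" by (rule UnionE)
  show ?thesis
  proof
    show "openin Y V"
      using Y(2) D(1) V unfolding locally_connected_space_open_connected_components by blast
    show "connectedin Y V"
      using connectedin_connected_components_of[OF V(1)] by (simp add: connectedin_subtopology)
    show "connectedin Y (topspace Y - V)"
      using connectedin_complement_of_component[OF Y D V(1)] .
    show "x \<in> V" by fact
    show "V \<inter> D = {}" using connected_components_of_subset[OF V(1)] by auto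
    fix S assume S: "connectedin Y S" "S \<inter> D = {}" "S \<inter> V \<noteq> {}"
    then have "connectedin ?Z S"
      using connectedin_subset_topspace by (simp add: connectedin_subtopology) blast
    then show "S \<subseteq> V"
      using S connected_components_of_maximal[OF V(1)] by (simp add: disjnt_def Int_commute)
  qed
qed

locale three_points =
  fixes Y :: "'b topology" and P :: "'b set"
  assumes compact: "compact_space Y" and Hausdorff: "Hausdorff_space Y"
    and connected: "connected_space Y" and locally_connected: "locally_connected_space Y"
    and P: "P \<subseteq> topspace Y" "card P = 3"
begin

lemma two_of_three_meet:
  assumes "x \<in> P" "y \<in> P" "x \<noteq> y" "x' \<in> P" "y' \<in> P" "x' \<noteq> y'"
  shows "{x, y} \<inter> {x', y'} \<noteq> {}"
  using P(2) assms by (auto simp: card_3_iff)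

lemma finite_P: "finite P"
  using P(2) card.infinite by fastforce

lemma empty_not_separating: "\<not> separates_points Y P {}"
proof -
  obtain a b where "a \<in> P" "b \<in> P" "a \<noteq> b" using P(2) by (auto simp: card_3_iff)
  then show ?thesis
    using P(1) connected unfolding separates_points_def connectedin_topspace[symmetric] by blast
qed

text \<open>\<open>E\<close> lies in one component \<open>V\<close> of the complement of \<open>D\<close>, and the complement of \<open>V\<close> is connected and
misses \<open>E\<close>. Since \<open>D\<close> separates the points, \<open>V\<close> contains at most one of the three, and since \<open>E\<close>
separates them, so does the complement of \<open>V\<close>; but one of the two must contain two of them.\<close>

lemma disjoint_separators_False:
  assumes D: "compactin Y D" "connectedin Y D" "separates_points Y P D"
    and E: "connectedin Y E" "separates_points Y P E" and disj: "D \<inter> E = {}"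
  shows False
proof -
  have "D \<noteq> {}" "E \<noteq> {}" using D E empty_not_separating by blast+
  then obtain e where e: "e \<in> E" by blast
  then have "e \<in> topspace Y - D" using disj connectedin_subset_topspace[OF E(1)] by blast
  with complement_componentE[OF connected locally_connected compactin_imp_closedin[OF Hausdorff D(1)] D(2) \<open>D \<noteq> {}\<close>]
  obtain V where V: "connectedin Y V" "connectedin Y (topspace Y - V)" "e \<in> V" "V \<inter> D = {}"
    "\<And>S. connectedin Y S \<Longrightarrow> S \<inter> D = {} \<Longrightarrow> S \<inter> V \<noteq> {} \<Longrightarrow> S \<subseteq> V" by metis
  have "E \<subseteq> V" using V(5)[OF E(1)] disj e V(3) by blast
  have one: "\<forall>x\<in>V \<inter> P. \<forall>y\<in>V \<inter> P. x = y"
    using D(3) V(1,4) unfolding separates_points_def by blast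
  moreover have two: "\<forall>x\<in>(topspace Y - V) \<inter> P. \<forall>y\<in>(topspace Y - V) \<inter> P. x = y"
    using E(2) V(2) \<open>E \<subseteq> V\<close> unfolding separates_points_def by blast
  obtain a b c where abc: "P = {a, b, c}" "a \<noteq> b" "b \<noteq> c" "a \<noteq> c"
    using P(2) by (auto simp: card_3_iff)
  then have "a \<in> topspace Y" "b \<in> topspace Y" "c \<in> topspace Y" using P(1) by auto
  with one two abc show False by blast
qed

corollary contains_separator_disjoint_False:
  assumes "contains_separator Y P U" "contains_separator Y P V" "U \<inter> V = {}"
  shows False
proof -
  obtain D where D: "compactin Y D" "connectedin Y D" "separates_points Y P D" "D \<subseteq> U"
    using assms(1) unfolding contains_separator_def by blast
  obtain E where E: "compactin Y E" "connectedin Y E" "separates_points Y P E" "E \<subseteq> V"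
    using assms(2) unfolding contains_separator_def by blast
  show False
    using disjoint_separators_False[OF D(1-3) E(2,3)] D(4) E(4) assms(3) by blast
qed

text \<open>A compact connected set that does not separate the points is filled in: the complement of \<open>V\<close> is a
closed solid set that contains \<open>D\<close> and at most one of the three points.\<close>

lemma nonseparating_hull:
  assumes D: "compactin Y D" "connectedin Y D" "D \<noteq> {}" "\<not> separates_points Y P D"
  obtains V where "openin Y V" "connectedin Y V" "connectedin Y (topspace Y - V)" "V \<inter> D = {}"
    "\<exists>x\<in>P \<inter> V. \<exists>y\<in>P \<inter> V. x \<noteq> y"
    "\<And>S. connectedin Y S \<Longrightarrow> S \<inter> D = {} \<Longrightarrow> S \<inter> V \<noteq> {} \<Longrightarrow> S \<subseteq> V"
proof -
  obtain S x y where S: "connectedin Y S" "S \<inter> D = {}" "x \<in> S" "x \<in> P" "y \<in> S" "y \<in> P" "x \<noteq> y"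
    using D(4) unfolding separates_points_def by blast
  have x: "x \<in> topspace Y - D" using S P(1) by blast
  show ?thesis
  proof (rule complement_componentE[OF connected locally_connected compactin_imp_closedin[OF Hausdorff D(1)] D(2,3) x])
    fix V assume V: "openin Y V" "connectedin Y V" "connectedin Y (topspace Y - V)" "x \<in> V" "V \<inter> D = {}"
      and max: "\<And>S. connectedin Y S \<Longrightarrow> S \<inter> D = {} \<Longrightarrow> S \<inter> V \<noteq> {} \<Longrightarrow> S \<subseteq> V"
    have "S \<subseteq> V" using max[OF S(1,2)] S(3) V(4) by blast
    then have "\<exists>x\<in>P \<inter> V. \<exists>y\<in>P \<inter> V. x \<noteq> y" using S by blast
    from that[OF V(1,2,3,5) this max] show thesis .
  qed
qed

text \<open>In terms of the filled-in sets, that is, of the complements of \<open>V\<close> and \<open>V'\<close>: two of them that come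
from disjoint sets are nested or disjoint. The reason for choosing three points enters here: \<open>V\<close> and
\<open>V'\<close> contain two of them each, so they intersect.\<close>

lemma solid_hulls_laminar:
  assumes D: "connectedin Y D" "D \<noteq> {}" and D': "connectedin Y D'" and disj: "D \<inter> D' = {}"
    and V: "connectedin Y V" "connectedin Y (topspace Y - V)" "V \<inter> D = {}" "\<exists>x\<in>P \<inter> V. \<exists>y\<in>P \<inter> V. x \<noteq> y"
      "\<And>S. connectedin Y S \<Longrightarrow> S \<inter> D = {} \<Longrightarrow> S \<inter> V \<noteq> {} \<Longrightarrow> S \<subseteq> V"
    and V': "connectedin Y V'" "V' \<inter> D' = {}" "\<exists>x\<in>P \<inter> V'. \<exists>y\<in>P \<inter> V'. x \<noteq> y"
      "\<And>S. connectedin Y S \<Longrightarrow> S \<inter> D' = {} \<Longrightarrow> S \<inter> V' \<noteq> {} \<Longrightarrow> S \<subseteq> V'"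
  shows "V \<subseteq> V' \<or> V' \<subseteq> V \<or> topspace Y - V \<subseteq> V'"
proof -
  obtain x y x' y' where "x \<in> P \<inter> V" "y \<in> P \<inter> V" "x \<noteq> y" "x' \<in> P \<inter> V'" "y' \<in> P \<inter> V'" "x' \<noteq> y'"
    using V(4) V'(3) by blast
  then have meet: "V \<inter> V' \<noteq> {}"
    using two_of_three_meet[of x y x' y'] by auto
  show ?thesis
  proof (cases "D' \<inter> V = {} \<or> D \<inter> V' = {}")
    case True
    then show ?thesis
      using V'(4)[OF V(1)] V(5)[OF V'(1)] meet by (simp add: Int_commute) blast
  next
    case False
    then have "D' \<subseteq> V" "D \<inter> V' \<noteq> {}" using V(5)[OF D'] disj by auto
    moreover have "D \<subseteq> topspace Y - V" using V(3) connectedin_subset_topspace[OF D(1)] by blast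
    ultimately show ?thesis
      using V'(4)[OF V(2)] by blast
  qed
qed

end

locale three_points_genus_zero = three_points Y P for Y :: "'b topology" and P +
  assumes genus_zero: "genus_zero Y"
begin

text \<open>This is the only place where genus 0 is used. Cover \<open>C\<close> by finitely many disjoint compact connected
subsets of \<open>U\<close>. None of them separates the points, so they can be filled in to closed solid sets with
at most one of the points in each. The maximal filled-in sets are pairwise disjoint, so by genus 0 the
complement \<open>G\<close> of their union is connected. Inside \<open>G\<close> there is then a compact connected set that
contains those of the points that lie in \<open>G\<close> and the frontiers of small neighbourhoods of the maximal
sets; it locks every other point into its own solid set and therefore separates the three points.\<close>

lemma complement_contains_separator:
  assumes C: "closedin Y C" and U: "openin Y U" "C \<subseteq> U" and nsep: "\<not> contains_separator Y P U"
  shows "contains_separator Y P (topspace Y - C)"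
proof -
  have lcpt: "locally_compact_space Y" using compact by (rule compact_imp_locally_compact_space)
  have cpt: "compactin Y A \<longleftrightarrow> closedin Y A" for A
    using closedin_compact_space[OF compact] compactin_imp_closedin[OF Hausdorff] by blast
  define CC where "CC = connected_components_of (subtopology Y U)"
  have UCC: "\<Union>CC = U" using U(1) by (simp add: CC_def Union_connected_components_of openin_subset inf.absorb2)
  have opn: "openin Y W" if "W \<in> CC" for W
    using locally_connected U(1) that unfolding CC_def locally_connected_space_open_connected_components by blast
  have conn: "connectedin Y W" if "W \<in> CC" for W
    using connectedin_connected_components_of[OF that[unfolded CC_def]] by (simp add: connectedin_subtopology)
  have pdisj: "W \<inter> W' = {}" if "W \<in> CC" "W' \<in> CC" "W \<noteq> W'" for W W'
    using pairwiseD[OF pairwise_disjoint_connected_components_of[of "subtopology Y U"] that[unfolded CC_def]] by (simp add: disjnt_def)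
  obtain \<G>0 where \<G>0: "finite \<G>0" "\<G>0 \<subseteq> CC" "C \<subseteq> \<Union>\<G>0"
    using compactinD[of Y C CC] C cpt opn U(2) UCC by metis
  define \<G> where "\<G> = {W \<in> \<G>0. W \<inter> C \<noteq> {}}"
  have \<G>: "finite \<G>" "\<G> \<subseteq> CC" "C \<subseteq> \<Union>\<G>" "\<And>W. W \<in> \<G> \<Longrightarrow> W \<inter> C \<noteq> {}"
    unfolding \<G>_def using \<G>0 by (simp, blast, blast, simp)
  have exD: "\<exists>D. compactin Y D \<and> connectedin Y D \<and> C \<inter> W \<subseteq> D \<and> D \<subseteq> W" if W: "W \<in> \<G>" for W
  proof -
    have WC: "W \<in> CC" using W \<G>(2) by blast
    have "U - W = \<Union>(CC - {W})"
      using complement_connected_components_of_Union[OF WC[unfolded CC_def]] openin_subset[OF U(1)]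
      by (simp add: CC_def inf.absorb2)
    then have "C \<inter> W = C - \<Union>(CC - {W})" using U(2) by blast
    moreover have "openin Y (\<Union>(CC - {W}))" by (rule openin_Union) (use opn in auto)
    ultimately have "compactin Y (C \<inter> W)" using C cpt by (simp add: closedin_diff)
    from compact_connected_hull_in_connected_open[OF locally_connected lcpt Hausdorff opn[OF WC] conn[OF WC] this]
    show ?thesis by (metis inf_le2)
  qed
  then obtain D where D: "\<And>W. W \<in> \<G> \<Longrightarrow> compactin Y (D W) \<and> connectedin Y (D W) \<and> C \<inter> W \<subseteq> D W \<and> D W \<subseteq> W"
    by metis
  have Dne: "D W \<noteq> {}" if "W \<in> \<G>" for W using D[OF that] \<G>(4)[OF that] by blast
  have Dns: "\<not> separates_points Y P (D W)" if W: "W \<in> \<G>" for W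
  proof
    assume "separates_points Y P (D W)"
    moreover have "D W \<subseteq> U" using D[OF W] W \<G>(2) UCC by blast
    ultimately show False using nsep D[OF W] unfolding contains_separator_def by blast
  qed
  have "\<exists>V. openin Y V \<and> connectedin Y V \<and> connectedin Y (topspace Y - V) \<and> V \<inter> D W = {} \<and>
      (\<exists>x\<in>P \<inter> V. \<exists>y\<in>P \<inter> V. x \<noteq> y) \<and>
      (\<forall>S. connectedin Y S \<longrightarrow> S \<inter> D W = {} \<longrightarrow> S \<inter> V \<noteq> {} \<longrightarrow> S \<subseteq> V)" if W: "W \<in> \<G>" for W
    using nonseparating_hull[of "D W"] D[OF W] Dne[OF W] Dns[OF W] by metis
  then obtain V where V: "\<And>W. W \<in> \<G> \<Longrightarrow> openin Y (V W) \<and> connectedin Y (V W) \<and> connectedin Y (topspace Y - V W) \<and> V W \<inter> D W = {} \<and>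
      (\<exists>x\<in>P \<inter> V W. \<exists>y\<in>P \<inter> V W. x \<noteq> y) \<and>
      (\<forall>S. connectedin Y S \<longrightarrow> S \<inter> D W = {} \<longrightarrow> S \<inter> V W \<noteq> {} \<longrightarrow> S \<subseteq> V W)"
    by metis
  define S where "S W = topspace Y - V W" for W
  have DS: "D W \<subseteq> S W" if "W \<in> \<G>" for W
    using V[OF that] D[OF that] compactin_subset_topspace[of Y "D W"] unfolding S_def by blast
  have lam: "S W' \<subseteq> S W \<or> S W \<subseteq> S W' \<or> S W \<inter> S W' = {}" if W: "W \<in> \<G>" "W' \<in> \<G>" for W W'
  proof (cases "W = W'")
    case False
    then have "W \<inter> W' = {}" using pdisj[of W W'] W \<G>(2) by (meson subsetD)
    then have "D W \<inter> D W' = {}" using D[OF W(1)] D[OF W(2)] by blast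
    then have "V W \<subseteq> V W' \<or> V W' \<subseteq> V W \<or> topspace Y - V W \<subseteq> V W'"
      using D[OF W(1)] D[OF W(2)] V[OF W(1)] V[OF W(2)] Dne[OF W(1)]
      by (intro solid_hulls_laminar[of "D W" "D W'"]) simp_all
    then show ?thesis unfolding S_def by blast
  qed simp
  have Scl: "closedin Y (S W)" if "W \<in> \<G>" for W
    using V[OF that] unfolding S_def by blast
  have Ssolid: "solid_in Y (S W)" if "W \<in> \<G>" for W
  proof -
    have "topspace Y - (topspace Y - V W) = V W"
      using V[OF that] openin_subset[of Y "V W"] by blast
    then show ?thesis using V[OF that] unfolding solid_in_def S_def by simp
  qed
  (* The region V W takes two of the three points, which leaves at most one for S W. *)
  have Sone: "x = y" if W: "W \<in> \<G>" and xy: "x \<in> S W" "y \<in> S W" "x \<in> P" "y \<in> P" for W x y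
  proof (rule ccontr)
    assume "x \<noteq> y"
    moreover obtain x' y' where "x' \<in> P \<inter> V W" "y' \<in> P \<inter> V W" "x' \<noteq> y'" using V[OF W] by blast
    ultimately have "{x, y} \<inter> {x', y'} \<noteq> {}" using two_of_three_meet xy by simp
    then show False using xy(1,2) \<open>x' \<in> _\<close> \<open>y' \<in> _\<close> unfolding S_def by auto
  qed
  define \<M> where "\<M> = {M \<in> S ` \<G>. \<forall>T\<in>S ` \<G>. M \<subseteq> T \<longrightarrow> M = T}"
  have \<M>: "finite \<M>" "\<And>M. M \<in> \<M> \<Longrightarrow> \<exists>W\<in>\<G>. M = S W" using \<G>(1) unfolding \<M>_def by auto
  have \<M>disj: "pairwise disjnt \<M>"
    unfolding pairwise_def disjnt_def
  proof (intro ballI impI)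
    fix M M' assume M: "M \<in> \<M>" "M' \<in> \<M>" "M \<noteq> M'"
    obtain W W' where W: "W \<in> \<G>" "W' \<in> \<G>" "M = S W" "M' = S W'"
      using \<M>(2)[OF M(1)] \<M>(2)[OF M(2)] by blast
    have "\<not> M \<subseteq> M'" "\<not> M' \<subseteq> M" using M W unfolding \<M>_def by auto
    then show "M \<inter> M' = {}" using lam[OF W(1,2)] W(3,4) by blast
  qed
  have CM: "C \<subseteq> \<Union>\<M>"
  proof
    fix x assume x: "x \<in> C"
    then obtain W where W: "W \<in> \<G>" "x \<in> W" using \<G>(3) by blast
    then have xS: "x \<in> S W" using D[OF W(1)] DS[OF W(1)] x by blast
    obtain M where "M \<in> S ` \<G>" "S W \<subseteq> M" "\<forall>b\<in>S ` \<G>. M \<subseteq> b \<longrightarrow> M = b"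
      using finite_has_maximal2[of "S ` \<G>" "S W"] \<G>(1) W(1) by blast
    then show "x \<in> \<Union>\<M>" using xS unfolding \<M>_def by blast
  qed
  define G where "G = topspace Y - \<Union>\<M>"
  have \<M>cl: "closedin Y M" "solid_in Y M" if "M \<in> \<M>" for M
    using \<M>(2)[OF that] Scl Ssolid by auto
  have Gconn: "connectedin Y G"
    using genus_zero \<M>(1) \<M>disj \<M>cl unfolding genus_zero_def G_def by blast
  have "closedin Y (\<Union>\<M>)" by (rule closedin_Union[OF \<M>(1) \<M>cl(1)])
  then have Gopen: "openin Y G" unfolding G_def by blast
  have "normal_space Y" using compact Hausdorff compact_Hausdorff_or_regular_imp_normal_space by blast
  have exN: "\<exists>N. openin Y N \<and> M \<subseteq> N \<and> (\<Union>(\<M> - {M}) \<union> (P - M)) \<inter> Y closure_of N = {}" if M: "M \<in> \<M>" for M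
  proof -
    have "closedin Y (\<Union>(\<M> - {M}))" using \<M>(1) \<M>cl(1) by (intro closedin_Union) auto
    moreover have "closedin Y (P - M)" using P(1) finite_P Hausdorff by (intro closedin_Hausdorff_finite) auto
    ultimately have "closedin Y (\<Union>(\<M> - {M}) \<union> (P - M))" by (rule closedin_Un)
    moreover have "M \<inter> (\<Union>(\<M> - {M}) \<union> (P - M)) = {}"
      using \<M>disj M unfolding pairwise_def disjnt_def by auto
    ultimately show ?thesis
      using \<open>normal_space Y\<close> \<M>cl(1)[OF M] unfolding normal_space disjnt_def by blast
  qed
  then obtain N where N: "\<And>M. M \<in> \<M> \<Longrightarrow> openin Y (N M) \<and> M \<subseteq> N M \<and> (\<Union>(\<M> - {M}) \<union> (P - M)) \<inter> Y closure_of N M = {}"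
    by metis
  define B where "B = \<Union>((\<lambda>M. Y frontier_of N M) ` \<M>) \<union> (P \<inter> G)"
  have fr: "Y frontier_of N M = Y closure_of N M - N M" if "M \<in> \<M>" for M
    using N[OF that] by (simp add: frontier_of_openin)
  have "closedin Y (\<Union>((\<lambda>M. Y frontier_of N M) ` \<M>))" using \<M>(1) closedin_frontier_of by (intro closedin_Union) auto
  moreover have "closedin Y (P \<inter> G)" using P(1) finite_P Hausdorff by (intro closedin_Hausdorff_finite) auto
  ultimately have Bcpt: "compactin Y B" unfolding B_def cpt by (rule closedin_Un)
  have BG: "B \<subseteq> G"
  proof -
    have "Y frontier_of N M \<inter> M' = {}" if "M \<in> \<M>" "M' \<in> \<M>" for M M'
      using N[OF that(1)] fr[OF that(1)] that(2) by (cases "M' = M") blast+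
    then show ?thesis unfolding B_def G_def using frontier_of_subset_topspace[of Y] by blast
  qed
  obtain E where E: "compactin Y E" "connectedin Y E" "B \<subseteq> E" "E \<subseteq> G"
    using compact_connected_hull_in_connected_open[OF locally_connected lcpt Hausdorff Gopen Gconn Bcpt BG] .
  have "separates_points Y P E"
    unfolding separates_points_def
  proof (intro allI impI ballI)
    fix T x y assume T: "connectedin Y T \<and> T \<inter> E = {}" and x: "x \<in> T \<inter> P" and y: "y \<in> T \<inter> P"
    have "x \<notin> G" using T x E(3) unfolding B_def by blast
    then obtain M where M: "M \<in> \<M>" "x \<in> M" using x P(1) unfolding G_def by blast
    have "T \<inter> Y frontier_of N M = {}" using T E(3) M(1) unfolding B_def by blast
    moreover have "T \<inter> N M \<noteq> {}" using x M N[OF M(1)] by blast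
    ultimately have "T \<subseteq> N M" using connectedin_Int_frontier_of[of Y T "N M"] T by blast
    moreover have "N M \<subseteq> Y closure_of N M" using N[OF M(1)] closure_of_subset openin_subset by metis
    ultimately have "y \<in> M" using y N[OF M(1)] by blast
    then show "x = y" using \<M>(2)[OF M(1)] Sone M(2) x y by blast
  qed
  moreover have "E \<subseteq> topspace Y - C" using E(4) CM unfolding G_def by blast
  ultimately show ?thesis unfolding contains_separator_def using E by blast
qed

end

section \<open>The three-point topological measure\<close>

context three_points_genus_zero
begin

text \<open>On open sets this is the same as containing a separator. For closed sets it is the value forced by
outer regularity.\<close>

definition surrounds_separator :: "'b set \<Rightarrow> bool" where
  "surrounds_separator A \<longleftrightarrow> (\<forall>U. openin Y U \<and> A \<subseteq> U \<longrightarrow> contains_separator Y P U)"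

lemma surrounds_separator_open:
  "openin Y U \<Longrightarrow> surrounds_separator U \<longleftrightarrow> contains_separator Y P U"
  unfolding surrounds_separator_def using contains_separator_mono by blast

lemma surrounds_separator_mono:
  "surrounds_separator A \<Longrightarrow> A \<subseteq> B \<Longrightarrow> surrounds_separator B"
  unfolding surrounds_separator_def by (meson order_trans)

lemma disjoint_neighbourhoods:
  assumes "closedin Y A" "closedin Y B" "A \<inter> B = {}"
  obtains U V where "openin Y U" "openin Y V" "A \<subseteq> U" "B \<subseteq> V" "U \<inter> V = {}"
  using compact_Hausdorff_or_regular_imp_normal_space[OF compact] Hausdorff assms
  unfolding normal_space_def disjnt_def by metis

text \<open>Disjoint sets cannot both contain a separator, and by \<open>complement_contains_separator\<close> one of \<open>C\<close> and
its complement always does: the set function takes the value 1 on exactly one of them. This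
duality yields the additivity of a topological measure.\<close>

lemma surrounds_separator_closed_complement:
  assumes "closedin Y C"
  shows "surrounds_separator (topspace Y - C) \<longleftrightarrow> \<not> surrounds_separator C"
proof
  have op: "openin Y (topspace Y - C)" using assms by blast
  show "\<not> surrounds_separator C" if "surrounds_separator (topspace Y - C)"
  proof
    assume C: "surrounds_separator C"
    from that obtain D where D: "compactin Y D" "connectedin Y D" "separates_points Y P D" "D \<subseteq> topspace Y - C"
      unfolding surrounds_separator_open[OF op] contains_separator_def by blast
    have "openin Y (topspace Y - D)" using compactin_imp_closedin[OF Hausdorff D(1)] by blast
    moreover have "C \<subseteq> topspace Y - D" using D(4) closedin_subset[OF assms] by blast
    ultimately have "contains_separator Y P (topspace Y - D)" using C unfolding surrounds_separator_def by blast
    moreover have "contains_separator Y P D" using D unfolding contains_separator_def by blast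
    ultimately show False using contains_separator_disjoint_False[of D "topspace Y - D"] by blast
  qed
  show "surrounds_separator (topspace Y - C)" if nC: "\<not> surrounds_separator C"
  proof -
    from nC obtain U where "openin Y U" "C \<subseteq> U" "\<not> contains_separator Y P U"
      unfolding surrounds_separator_def by blast
    then show ?thesis
      unfolding surrounds_separator_open[OF op] using complement_contains_separator[OF assms] by blast
  qed
qed

lemma surrounds_separator_complement:
  assumes "A \<in> open_or_closed_sets Y"
  shows "surrounds_separator (topspace Y - A) \<longleftrightarrow> \<not> surrounds_separator A"
proof (cases "closedin Y A")
  case True
  then show ?thesis by (rule surrounds_separator_closed_complement)
next
  case False
  then have "openin Y A" using assms unfolding open_or_closed_sets_def by blast
  then have "closedin Y (topspace Y - A)" "topspace Y - (topspace Y - A) = A"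
    using openin_subset by blast+
  then show ?thesis using surrounds_separator_closed_complement by metis
qed

lemma not_both_surround_separator:
  assumes "A \<in> open_or_closed_sets Y" "A \<inter> B = {}" "B \<subseteq> topspace Y" "surrounds_separator A"
  shows "\<not> surrounds_separator B"
proof
  assume "surrounds_separator B"
  moreover have "B \<subseteq> topspace Y - A" using assms(2,3) by blast
  ultimately have "surrounds_separator (topspace Y - A)" by (rule surrounds_separator_mono)
  with surrounds_separator_complement assms(1,4) show False by blast
qed

lemma surrounds_separator_Un_open:
  assumes "openin Y A" "openin Y B" "A \<inter> B = {}"
  shows "surrounds_separator (A \<union> B) \<longleftrightarrow> surrounds_separator A \<or> surrounds_separator B"
proof
  assume "surrounds_separator (A \<union> B)"
  then obtain D where D: "compactin Y D" "connectedin Y D" "separates_points Y P D" "D \<subseteq> A \<union> B"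
    using surrounds_separator_open[of "A \<union> B"] assms openin_Un unfolding contains_separator_def by blast
  have "D \<inter> A = {} \<or> D \<inter> B = {}"
    using D(2,4) assms unfolding connectedin by blast
  then have "D \<subseteq> A \<or> D \<subseteq> B" using D(4) by blast
  then show "surrounds_separator A \<or> surrounds_separator B"
    using D assms surrounds_separator_open unfolding contains_separator_def by blast
qed (meson surrounds_separator_mono Un_upper1 Un_upper2)

lemma surrounds_separator_Un_closed:
  assumes A: "closedin Y A" and B: "closedin Y B" and "A \<inter> B = {}"
  shows "surrounds_separator (A \<union> B) \<longleftrightarrow> surrounds_separator A \<or> surrounds_separator B"
proof
  assume AB: "surrounds_separator (A \<union> B)"
  show "surrounds_separator A \<or> surrounds_separator B"
  proof (rule ccontr)
    assume "\<not> ?thesis"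
    then obtain U V where U: "openin Y U" "A \<subseteq> U" "\<not> contains_separator Y P U"
      and V: "openin Y V" "B \<subseteq> V" "\<not> contains_separator Y P V"
      unfolding surrounds_separator_def by blast
    obtain U' V' where U'V': "openin Y U'" "openin Y V'" "A \<subseteq> U'" "B \<subseteq> V'" "U' \<inter> V' = {}"
      using disjoint_neighbourhoods[OF assms] .
    have op: "openin Y (U \<inter> U')" "openin Y (V \<inter> V')" using U V U'V' by blast+
    have "surrounds_separator (U \<inter> U' \<union> V \<inter> V')"
      by (rule surrounds_separator_mono[OF AB]) (use U V U'V' in blast)
    then have "surrounds_separator (U \<inter> U') \<or> surrounds_separator (V \<inter> V')"
      using surrounds_separator_Un_open[OF op] U'V'(5) by blast
    then have "contains_separator Y P (U \<inter> U') \<or> contains_separator Y P (V \<inter> V')"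
      using surrounds_separator_open op by blast
    then show False using U(3) V(3) contains_separator_mono by (meson inf_le1)
  qed
qed (meson surrounds_separator_mono Un_upper1 Un_upper2)

text \<open>By duality, this mixed case reduces to two open or to two closed sets: if the union is closed, its
complement and \<open>A\<close> are disjoint open sets whose union is the complement of \<open>B\<close>; if it is open, its
complement and \<open>B\<close> are disjoint closed sets whose union is the complement of \<open>A\<close>.\<close>

lemma surrounds_separator_Un_open_closed:
  assumes A: "openin Y A" and B: "closedin Y B" and disj: "A \<inter> B = {}"
    and W: "A \<union> B \<in> open_or_closed_sets Y"
  shows "surrounds_separator (A \<union> B) \<longleftrightarrow> surrounds_separator A \<or> surrounds_separator B"
proof
  let ?W = "A \<union> B"
  assume AB: "surrounds_separator ?W"
  have oc: "A \<in> open_or_closed_sets Y" "B \<in> open_or_closed_sets Y"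
    using A B unfolding open_or_closed_sets_def by blast+
  have sub: "A \<subseteq> topspace Y" "B \<subseteq> topspace Y" using A B openin_subset closedin_subset by blast+
  have nW: "\<not> surrounds_separator (topspace Y - ?W)"
    using surrounds_separator_complement[OF W] AB by blast
  show "surrounds_separator A \<or> surrounds_separator B"
  proof (cases "closedin Y ?W")
    case True
    then have op: "openin Y (topspace Y - ?W)" by blast
    have "topspace Y - B = A \<union> (topspace Y - ?W)" using disj sub by blast
    then have "surrounds_separator A \<or> surrounds_separator (topspace Y - ?W) \<or> surrounds_separator B"
      using surrounds_separator_complement[OF oc(2)] surrounds_separator_Un_open[OF A op] by auto
    then show ?thesis using nW by blast
  next
    case False
    then have cl: "closedin Y (topspace Y - ?W)" using W unfolding open_or_closed_sets_def by blast
    have "topspace Y - A = B \<union> (topspace Y - ?W)" using disj sub by blast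
    then have "surrounds_separator B \<or> surrounds_separator (topspace Y - ?W) \<or> surrounds_separator A"
      using surrounds_separator_complement[OF oc(1)] surrounds_separator_Un_closed[OF B cl] by auto
    then show ?thesis using nW by blast
  qed
qed (meson surrounds_separator_mono Un_upper1 Un_upper2)

lemma surrounds_separator_Un:
  assumes A: "A \<in> open_or_closed_sets Y" and B: "B \<in> open_or_closed_sets Y"
    and W: "A \<union> B \<in> open_or_closed_sets Y" and disj: "A \<inter> B = {}"
  shows "surrounds_separator (A \<union> B) \<longleftrightarrow> surrounds_separator A \<or> surrounds_separator B"
proof -
  consider "openin Y A" "openin Y B" | "closedin Y A" "closedin Y B" | "openin Y A" "closedin Y B"
    | "closedin Y A" "openin Y B"
    using A B unfolding open_or_closed_sets_def by blast
  then show ?thesis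
  proof cases
    case 1 then show ?thesis using surrounds_separator_Un_open disj by blast
  next
    case 2 then show ?thesis using surrounds_separator_Un_closed disj by blast
  next
    case 3 then show ?thesis using surrounds_separator_Un_open_closed disj W by blast
  next
    case 4 
    then show ?thesis
      using surrounds_separator_Un_open_closed[of B A] disj W by (metis Int_commute Un_commute)
  qed
qed

end

text \<open>The measure is wanted on \<open>X\<close>, while genus 0 is a property of its compactification. To treat the
compact and the noncompact case at once, \<open>X\<close> is embedded as an open subset of \<open>Y\<close>: below, \<open>e\<close> is the
identity if \<open>X\<close> is compact and \<open>Some\<close> otherwise.\<close>

locale embedded_three_points = three_points_genus_zero Y P for Y :: "'b topology" and P +
  fixes X :: "'a topology" and e :: "'a \<Rightarrow> 'b"
  assumes e_cont: "continuous_map X Y e" and e_open: "open_map X Y e" and e_inj: "inj_on e (topspace X)"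
begin

text \<open>Separation is tested in \<open>Y\<close>, but the neighbourhoods \<open>U\<close> range over the open sets of \<open>X\<close>. For a closed
noncompact set this makes a difference, since its closure in \<open>Y\<close> contains the point at infinity.\<close>

definition three_point_measure :: "'a set \<Rightarrow> ennreal" where
  "three_point_measure =
     restrict (\<lambda>A. if \<forall>U. openin X U \<and> A \<subseteq> U \<longrightarrow> contains_separator Y P (e ` U) then 1 else 0)
       (open_or_closed_sets X)"

lemma three_point_measure_open:
  assumes "openin X U"
  shows "three_point_measure U = (if contains_separator Y P (e ` U) then 1 else 0)"
proof -
  have "(\<forall>V. openin X V \<and> U \<subseteq> V \<longrightarrow> contains_separator Y P (e ` V)) \<longleftrightarrow> contains_separator Y P (e ` U)"
    using assms contains_separator_mono[of Y P "e ` U"] image_mono[of U _ e] by (meson order_refl)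
  then show ?thesis
    using assms by (simp add: three_point_measure_def open_or_closed_sets_def)
qed

lemma three_point_measure_mono:
  assumes "A \<in> open_or_closed_sets X" "B \<in> open_or_closed_sets X" "A \<subseteq> B"
  shows "three_point_measure A \<le> three_point_measure B"
proof -
  have "(\<forall>U. openin X U \<and> A \<subseteq> U \<longrightarrow> contains_separator Y P (e ` U)) \<Longrightarrow>
        (\<forall>U. openin X U \<and> B \<subseteq> U \<longrightarrow> contains_separator Y P (e ` U))"
    using assms(3) by (meson order_trans)
  then show ?thesis using assms(1,2) by (auto simp: three_point_measure_def)
qed

lemma X_Hausdorff: "Hausdorff_space X"
  using Hausdorff_space_injective_preimage[OF Hausdorff e_cont e_inj] .

text \<open>Open neighbourhoods in \<open>Y\<close> can be shrunk to open subsets of \<open>X\<close>, so on these sets the measure is the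
restriction of the set function on \<open>Y\<close> and inherits its additivity.\<close>

lemma three_point_measure_compact_or_open:
  assumes A: "compactin X A \<or> openin X A"
  shows "three_point_measure A = (if surrounds_separator (e ` A) then 1 else 0)"
    and "e ` A \<in> open_or_closed_sets Y"
proof -
  have oc: "A \<in> open_or_closed_sets X"
    using A compactin_imp_closedin[OF X_Hausdorff] unfolding open_or_closed_sets_def by blast
  then have A_sub: "A \<subseteq> topspace X" using openin_subset closedin_subset unfolding open_or_closed_sets_def by blast
  show "e ` A \<in> open_or_closed_sets Y"
    using A e_open image_compactin[OF _ e_cont] compactin_imp_closedin[OF Hausdorff]
    unfolding open_or_closed_sets_def open_map_def by blast
  have "(\<forall>U. openin X U \<and> A \<subseteq> U \<longrightarrow> contains_separator Y P (e ` U)) \<longleftrightarrow> surrounds_separator (e ` A)"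
  proof
    assume L: "\<forall>U. openin X U \<and> A \<subseteq> U \<longrightarrow> contains_separator Y P (e ` U)"
    show "surrounds_separator (e ` A)"
      unfolding surrounds_separator_def
    proof (intro allI impI)
      fix V assume V: "openin Y V \<and> e ` A \<subseteq> V"
      let ?U = "{x \<in> topspace X. e x \<in> V}"
      have "openin X ?U" using V openin_continuous_map_preimage[OF e_cont] by blast
      moreover have "A \<subseteq> ?U" using V A_sub by blast
      ultimately have "contains_separator Y P (e ` ?U)" using L by blast
      then show "contains_separator Y P V" by (rule contains_separator_mono) blast
    qed
  next
    assume "surrounds_separator (e ` A)"
    then show "\<forall>U. openin X U \<and> A \<subseteq> U \<longrightarrow> contains_separator Y P (e ` U)"
      using e_open unfolding surrounds_separator_def open_map_def by (meson image_mono)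
  qed
  then show "three_point_measure A = (if surrounds_separator (e ` A) then 1 else 0)"
    using oc by (simp add: three_point_measure_def)
qed

lemma three_point_measure_Un:
  assumes "\<forall>D\<in>{A, B, A \<union> B}. compactin X D \<or> openin X D" and disj: "disjnt A B"
  shows "three_point_measure (A \<union> B) = three_point_measure A + three_point_measure B"
proof -
  have A: "compactin X A \<or> openin X A" and B: "compactin X B \<or> openin X B"
    and W: "compactin X (A \<union> B) \<or> openin X (A \<union> B)" using assms(1) by auto
  have "A \<subseteq> topspace X" "B \<subseteq> topspace X"
    using A B openin_subset compactin_subset_topspace by blast+
  then have disj': "e ` A \<inter> e ` B = {}" and B': "e ` B \<subseteq> topspace Y"
    using disj e_inj continuous_map_image_subset_topspace[OF e_cont]
    unfolding disjnt_def inj_on_def by blast+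
  note oc = three_point_measure_compact_or_open(2)[OF A] three_point_measure_compact_or_open(2)[OF B]
    three_point_measure_compact_or_open(2)[OF W, unfolded image_Un]
  show ?thesis
    using surrounds_separator_Un[OF oc disj'] not_both_surround_separator[OF oc(1) disj' B']
    by (simp add: three_point_measure_compact_or_open(1)[OF A] three_point_measure_compact_or_open(1)[OF B]
      three_point_measure_compact_or_open(1)[OF W] image_Un)
qed

lemma three_point_measure_TM: "three_point_measure \<in> TM X"
proof -
  have compact_oc: "C \<in> open_or_closed_sets X" if "compactin X C" for C
    using that compactin_imp_closedin[OF X_Hausdorff] unfolding open_or_closed_sets_def by blast
  have open_oc: "U \<in> open_or_closed_sets X" if "openin X U" for U
    using that unfolding open_or_closed_sets_def by blast
  have le1: "three_point_measure A \<le> 1" if "A \<in> open_or_closed_sets X" for A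
    using that by (simp add: three_point_measure_def)
  have "inner_regular_on_open X three_point_measure"
    unfolding inner_regular_on_open_def
  proof (intro allI impI antisym)
    fix U assume U: "openin X U"
    show "(SUP C\<in>{C. compactin X C \<and> C \<subseteq> U}. three_point_measure C) \<le> three_point_measure U"
      by (intro SUP_least three_point_measure_mono) (use U compact_oc open_oc in auto)
    show "three_point_measure U \<le> (SUP C\<in>{C. compactin X C \<and> C \<subseteq> U}. three_point_measure C)"
    proof (cases "contains_separator Y P (e ` U)")
      case True
      then obtain D where D: "compactin Y D" "connectedin Y D" "separates_points Y P D" "D \<subseteq> e ` U"
        unfolding contains_separator_def by blast
      define C where "C = {x \<in> U. e x \<in> D}"
      have C: "C \<subseteq> U" "e ` C = D" "C \<subseteq> topspace X" using D(4) openin_subset[OF U] unfolding C_def by blast+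
      have "homeomorphic_map X (subtopology Y (e ` topspace X)) e"
        using injective_open_imp_embedding_map[OF e_cont e_open e_inj] unfolding embedding_map_def .
      moreover have "compactin (subtopology Y (e ` topspace X)) (e ` C)"
        using C D(1) image_mono[OF C(3), of e] by (simp add: compactin_subtopology)
      ultimately have Cc: "compactin X C" using homeomorphic_map_compactness[OF _ C(3)] by blast
      have "contains_separator Y P D" using D unfolding contains_separator_def by blast
      then have "surrounds_separator (e ` C)"
        unfolding surrounds_separator_def C(2) using contains_separator_mono by blast
      then have "three_point_measure C = 1" using three_point_measure_compact_or_open(1) Cc by simp
      then have "1 \<le> (SUP C\<in>{C. compactin X C \<and> C \<subseteq> U}. three_point_measure C)"
        using Cc C(1) by (intro SUP_upper2[of C]) auto
      then show ?thesis using le1[OF open_oc[OF U]] by (rule order_trans[rotated])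
    qed (simp add: three_point_measure_open[OF U])
  qed
  moreover have "outer_regular_on_closed X three_point_measure"
    unfolding outer_regular_on_closed_def
  proof (intro allI impI antisym)
    fix F assume F: "closedin X F"
    then have Foc: "F \<in> open_or_closed_sets X" unfolding open_or_closed_sets_def by blast
    show "three_point_measure F \<le> (INF U\<in>{U. openin X U \<and> F \<subseteq> U}. three_point_measure U)"
      by (intro INF_greatest three_point_measure_mono) (use Foc open_oc in auto)
    show "(INF U\<in>{U. openin X U \<and> F \<subseteq> U}. three_point_measure U) \<le> three_point_measure F"
    proof (cases "\<forall>U. openin X U \<and> F \<subseteq> U \<longrightarrow> contains_separator Y P (e ` U)")
      case True
      then have "three_point_measure F = 1" using Foc by (simp add: three_point_measure_def)
      moreover have "(INF U\<in>{U. openin X U \<and> F \<subseteq> U}. three_point_measure U) \<le> three_point_measure (topspace X)"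
        using closedin_subset[OF F] by (intro INF_lower) auto
      ultimately show ?thesis using le1[OF open_oc[OF openin_topspace]] by (metis order_trans)
    next
      case False
      then obtain U where U: "openin X U" "F \<subseteq> U" "\<not> contains_separator Y P (e ` U)" by blast
      have "(INF U\<in>{U. openin X U \<and> F \<subseteq> U}. three_point_measure U) \<le> three_point_measure U"
        using U by (intro INF_lower) auto
      also have "\<dots> = 0" using U by (simp add: three_point_measure_open)
      finally show ?thesis by simp
    qed
  qed
  moreover have "\<exists>A\<in>open_or_closed_sets X. three_point_measure A \<noteq> \<infinity>"
    using le1[OF open_oc[OF openin_topspace]] open_oc[OF openin_topspace]
    by (intro bexI[of _ "topspace X"]) (auto simp: top_unique)
  moreover have "three_point_measure \<in> extensional (open_or_closed_sets X)"
    unfolding three_point_measure_def by simp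
  moreover have "three_point_measure (topspace X) < \<infinity>"
    using le1[OF open_oc[OF openin_topspace]] by (rule order_le_less_trans) simp
  ultimately show ?thesis
    using three_point_measure_Un unfolding TM_def topological_measure_def by blast
qed

lemma connected_hull_of_points:
  assumes "openin Y W" "connectedin Y W" "Q \<subseteq> P \<inter> W"
  obtains D where "compactin Y D" "connectedin Y D" "Q \<subseteq> D" "D \<subseteq> W"
proof -
  have "finite Q" using assms(3) finite_P finite_subset by blast
  moreover have "Q \<subseteq> topspace Y" using assms(3) P(1) by blast
  ultimately have "compactin Y Q" by (rule finite_imp_compactin[rotated])
  then show ?thesis
    using compact_connected_hull_in_connected_open[OF locally_connected
        compact_imp_locally_compact_space[OF compact] Hausdorff assms(1,2)] that assms(3) by (metis le_inf_iff)
qed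

text \<open>Since \<open>e x\<close> is not a cut point, the other points of \<open>P\<close> can be joined by a compact connected set that
avoids it. This set contains at least two of the three points, so it separates them, and no set
disjoint from it contains a separator.\<close>

lemma three_point_measure_locally_null:
  assumes x: "x \<in> topspace X" and nocut: "connectedin Y (topspace Y - {e x})"
  shows "\<exists>U. openin X U \<and> x \<in> U \<and> three_point_measure U = 0"
proof -
  have "closedin Y {e x}"
    using Hausdorff x continuous_map_image_subset_topspace[OF e_cont] by (intro closedin_Hausdorff_singleton) blast+
  then have op: "openin Y (topspace Y - {e x})" by blast
  have "P - {e x} \<subseteq> P \<inter> (topspace Y - {e x})" using P(1) by blast
  then obtain D where D: "compactin Y D" "connectedin Y D" "P - {e x} \<subseteq> D" "D \<subseteq> topspace Y - {e x}"
    using connected_hull_of_points[OF op nocut] by metis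
  then have "separates_points Y P D" unfolding separates_points_def by blast
  then have sD: "contains_separator Y P D" using D unfolding contains_separator_def by blast
  let ?U = "{z \<in> topspace X. e z \<in> topspace Y - D}"
  have U: "openin X ?U"
    using openin_continuous_map_preimage[OF e_cont] compactin_imp_closedin[OF Hausdorff D(1)] by blast
  have "\<not> contains_separator Y P (e ` ?U)"
    using contains_separator_disjoint_False[OF sD] by blast
  then have "three_point_measure ?U = 0" using three_point_measure_open[OF U] by simp
  moreover have "x \<in> ?U" using x D(4) continuous_map_image_subset_topspace[OF e_cont] by blast
  ultimately show ?thesis using U by blast
qed

text \<open>All three points can be joined inside \<open>O'\<close>, and a connected set through all of them is a separator.\<close>

lemma three_point_measure_concentrated:
  assumes O: "openin X O'" "connectedin X O'" "P \<subseteq> e ` O'" and V: "openin X V"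
  shows "O' \<subseteq> V \<Longrightarrow> three_point_measure V = 1"
    and "O' \<inter> V = {} \<Longrightarrow> three_point_measure V = 0"
proof -
  have op: "openin Y (e ` O')" "connectedin Y (e ` O')"
    using O e_open connectedin_continuous_map_image[OF e_cont] unfolding open_map_def by blast+
  obtain D where D: "compactin Y D" "connectedin Y D" "P \<subseteq> D" "D \<subseteq> e ` O'"
    using connected_hull_of_points[OF op, of P] O(3) by blast
  then have "separates_points Y P D" unfolding separates_points_def by blast
  then have sO: "contains_separator Y P (e ` O')" using D unfolding contains_separator_def by blast
  show "three_point_measure V = 1" if "O' \<subseteq> V"
    using contains_separator_mono[OF sO image_mono[OF that]] three_point_measure_open[OF V] by simp
  show "three_point_measure V = 0" if "O' \<inter> V = {}"
  proof -
    have "e ` O' \<inter> e ` V = {}"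
      using that e_inj openin_subset[OF O(1)] openin_subset[OF V] unfolding inj_on_def by blast
    then show ?thesis
      using contains_separator_disjoint_False[OF sO] three_point_measure_open[OF V] by auto
  qed
qed

end

text \<open>A connected Hausdorff space with more than one point has no isolated points.\<close>

lemma infinite_openin_connected_space:
  assumes X: "connected_space X" "Hausdorff_space X" "\<nexists>x. topspace X = {x}"
    and V: "openin X V" "V \<noteq> {}"
  shows "infinite V"
proof -
  obtain x where x: "x \<in> V" using V(2) by blast
  then have "x \<in> topspace X" using openin_subset[OF V(1)] by blast
  then have "x \<in> X derived_set_of topspace X"
    using connectedin_imp_perfect[OF X(2), of "topspace X"] X(1,3) by (auto simp: connectedin_topspace)
  then have "infinite (topspace X \<inter> V)"
    using x V(1) derived_set_of_infinite_openin[OF X(2), of "topspace X"] by blast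
  then show ?thesis using openin_subset[OF V(1)] by (simp add: inf.absorb2)
qed

text \<open>The point at infinity is in the closure of \<open>X - {x}\<close>: a compact set that contains \<open>X - {x}\<close> would make
\<open>X\<close> compact.\<close>

lemma connectedin_Alexandroff_compactification_delete:
  assumes X: "Hausdorff_space X" "\<not> compact_space X" "x \<in> topspace X"
    and conn: "connectedin X (topspace X - {x})"
  shows "connectedin (Alexandroff_compactification X) (topspace (Alexandroff_compactification X) - {Some x})"
proof -
  let ?Y = "Alexandroff_compactification X"
  let ?S = "Some ` (topspace X - {x})"
  have "None \<in> ?Y closure_of ?S"
    unfolding in_closure_of
  proof (intro conjI allI impI)
    fix T assume T: "None \<in> T \<and> openin ?Y T"
    then obtain C where C: "compactin X C" "T = insert None (Some ` (topspace X - C))"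
      by (auto simp: openin_Alexandroff_compactification)
    have "\<not> topspace X - {x} \<subseteq> C"
    proof
      assume "topspace X - {x} \<subseteq> C"
      then have "topspace X = insert x C" using X(3) compactin_subset_topspace[OF C(1)] by blast
      moreover have "compactin X ({x} \<union> C)" using C(1) X(3) by (intro compactin_Un) auto
      ultimately show False using X(2) by (simp add: compact_space_def)
    qed
    then show "\<exists>y. y \<in> ?S \<and> y \<in> T" using C(2) by blast
  qed simp
  moreover have "connectedin ?Y ?S"
    using connectedin_continuous_map_image[OF continuous_map_Some conn] .
  ultimately have "connectedin ?Y (insert None ?S)"
    using connectedin_intermediate_closure_of[of ?Y ?S "insert None ?S"]
      closure_of_subset[of ?S ?Y] connectedin_subset_topspace[of ?Y ?S] by blast
  moreover have "topspace ?Y - {Some x} = insert None ?S" by auto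
  ultimately show ?thesis by simp
qed

text \<open>The substitute for a point mass: concentrated in an arbitrarily small connected open set \<open>V\<close> like a
point mass, but null near every single point, so that no Radon measure lies below it.\<close>

lemma concentrated_locally_null_TM:
  fixes X :: "'a topology"
  assumes X: "\<nexists>x. topspace X = {x}" "connected_space X" "locally_connected_space X"
      "locally_compact_space X" "Hausdorff_space X" "\<nexists>x. cut_point X x"
      "one_point_compactification_genus_zero X"
    and V: "openin X V" "connectedin X V" "V \<noteq> {}"
  shows "\<exists>\<kappa>\<in>TM X. (\<forall>x\<in>topspace X. \<exists>U. openin X U \<and> x \<in> U \<and> \<kappa> U = 0) \<and>
    (\<forall>W. openin X W \<longrightarrow> (V \<subseteq> W \<longrightarrow> \<kappa> W = 1) \<and> (V \<inter> W = {} \<longrightarrow> \<kappa> W = 0))"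
proof -
  have "infinite V" using infinite_openin_connected_space X V by blast
  then obtain Q where Q: "Q \<subseteq> V" "card Q = 3" by (meson infinite_arbitrarily_large)
  have QX: "Q \<subseteq> topspace X" using Q(1) openin_subset[OF V(1)] by blast
  have nocut: "connectedin X (topspace X - {x})" if "x \<in> topspace X" for x
    using X(6) that unfolding cut_point_def by blast
  show ?thesis
  proof (cases "compact_space X")
    case True
    interpret embedded_three_points X Q X id
    proof
      show "genus_zero X" using X(7) True by (simp add: one_point_compactification_genus_zero_def)
      show "open_map X X id" by (simp add: open_map_def)
    qed (use True X Q QX in auto)
    show ?thesis
    proof (intro bexI[of _ three_point_measure] conjI ballI allI impI)
      show "three_point_measure \<in> TM X" by (rule three_point_measure_TM)
      show "\<exists>U. openin X U \<and> x \<in> U \<and> three_point_measure U = 0" if "x \<in> topspace X" for x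
        using three_point_measure_locally_null[OF that] nocut[OF that] by simp
      show "three_point_measure W = 1" if "openin X W" "V \<subseteq> W" for W
        using three_point_measure_concentrated(1)[OF V(1,2) _ that(1)] Q(1) that by simp
      show "three_point_measure W = 0" if "openin X W" "V \<inter> W = {}" for W
        using three_point_measure_concentrated(2)[OF V(1,2) _ that(1)] Q(1) that by simp
    qed
  next
    case False
    let ?Y = "Alexandroff_compactification X"
    interpret embedded_three_points ?Y "Some ` Q" X Some
    proof
      show "genus_zero ?Y" using X(7) False by (simp add: one_point_compactification_genus_zero_def)
      show "open_map X ?Y Some" by (rule open_map_Some)
      show "continuous_map X ?Y Some" by (rule continuous_map_Some)
      show "Hausdorff_space ?Y" using X by (simp add: Hausdorff_space_Alexandroff_compactification)
      show "locally_connected_space ?Y" using locally_connected_Alexandroff_compactification[OF X(2-5) False] .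
      have "connectedin ?Y (Some ` topspace X)"
        using connectedin_continuous_map_image[OF continuous_map_Some, of X "topspace X"] X(2)
        by (simp add: connectedin_topspace)
      then show "connected_space ?Y"
        using connectedin_closure_of Alexandroff_compactification_dense[OF False] connectedin_topspace by metis
      show "card (Some ` Q) = 3" using Q(2) by (simp add: card_image)
    qed (use QX in auto)
    show ?thesis
    proof (intro bexI[of _ three_point_measure] conjI ballI allI impI)
      show "three_point_measure \<in> TM X" by (rule three_point_measure_TM)
      show "\<exists>U. openin X U \<and> x \<in> U \<and> three_point_measure U = 0" if "x \<in> topspace X" for x
        using three_point_measure_locally_null[OF that]
          connectedin_Alexandroff_compactification_delete[OF X(5) False that nocut[OF that]] by simp
      show "three_point_measure W = 1" if "openin X W" "V \<subseteq> W" for W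
        using three_point_measure_concentrated(1)[OF V(1,2) _ that(1)] Q(1) that by blast
      show "three_point_measure W = 0" if "openin X W" "V \<inter> W = {}" for W
        using three_point_measure_concentrated(2)[OF V(1,2) _ that(1)] Q(1) that by blast
    qed
  qed
qed

section \<open>Deficient topological measures\<close>

lemma openin_open_or_closed: "openin X U \<Longrightarrow> U \<in> open_or_closed_sets X"
  and closedin_open_or_closed: "closedin X F \<Longrightarrow> F \<in> open_or_closed_sets X"
  by (auto simp: open_or_closed_sets_def)

lemma compactin_open_or_closed: "Hausdorff_space X \<Longrightarrow> compactin X C \<Longrightarrow> C \<in> open_or_closed_sets X"
  by (simp add: closedin_open_or_closed compactin_imp_closedin)

lemma open_or_closed_subset_topspace: "A \<in> open_or_closed_sets X \<Longrightarrow> A \<subseteq> topspace X"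
  by (auto simp: open_or_closed_sets_def dest: openin_subset closedin_subset)

lemma compactin_diff_openin: "compactin X C \<Longrightarrow> openin X U \<Longrightarrow> compactin X (C - U)"
proof -
  assume C: "compactin X C" and U: "openin X U"
  have "C - U = C \<inter> (topspace X - U)" using compactin_subset_topspace[OF C] by blast
  moreover have "closedin X (topspace X - U)" using U by blast
  ultimately show ?thesis using compact_Int_closedin[OF C] by simp
qed

lemma DTM_add:
  "\<nu> \<in> DTM X \<Longrightarrow> compactin X C \<Longrightarrow> compactin X K \<Longrightarrow> C \<inter> K = {} \<Longrightarrow> \<nu> (C \<union> K) = \<nu> C + \<nu> K"
  by (simp add: DTM_def deficient_topological_measure_def disjnt_def)

lemma DTM_inner:
  "\<nu> \<in> DTM X \<Longrightarrow> openin X U \<Longrightarrow> \<nu> U = (SUP C\<in>{C. compactin X C \<and> C \<subseteq> U}. \<nu> C)"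
  by (simp add: DTM_def deficient_topological_measure_def inner_regular_on_open_def)

lemma DTM_outer:
  "\<nu> \<in> DTM X \<Longrightarrow> closedin X F \<Longrightarrow> \<nu> F = (INF U\<in>{U. openin X U \<and> F \<subseteq> U}. \<nu> U)"
  by (simp add: DTM_def deficient_topological_measure_def outer_regular_on_closed_def)

lemma DTM_mono:
  assumes \<nu>: "\<nu> \<in> DTM X" and AB: "A \<in> open_or_closed_sets X" "B \<in> open_or_closed_sets X" "A \<subseteq> B"
  shows "\<nu> A \<le> \<nu> B"
proof -
  have open_open: "\<nu> U \<le> \<nu> V" if "openin X U" "openin X V" "U \<subseteq> V" for U V
    unfolding DTM_inner[OF \<nu> that(1)] DTM_inner[OF \<nu> that(2)]
    using that(3) by (intro SUP_subset_mono) auto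
  have any_open: "\<nu> A \<le> \<nu> V" if "openin X V" "A \<subseteq> V" for V
  proof (cases "openin X A")
    case False
    then have "closedin X A" using AB(1) by (auto simp: open_or_closed_sets_def)
    then show ?thesis using that by (subst DTM_outer[OF \<nu>]) (auto intro: INF_lower)
  qed (use open_open that in blast)
  show ?thesis
  proof (cases "openin X B")
    case False
    then have "closedin X B" using AB(2) by (auto simp: open_or_closed_sets_def)
    then show ?thesis using AB(3) any_open by (subst (2) DTM_outer[OF \<nu>]) (auto intro!: INF_greatest)
  qed (use any_open AB(3) in blast)
qed

lemma DTM_finite:
  assumes "\<nu> \<in> DTM X" "A \<in> open_or_closed_sets X"
  shows "\<nu> A < \<infinity>"
proof -
  have "\<nu> A \<le> \<nu> (topspace X)"
    using DTM_mono[OF assms openin_open_or_closed[OF openin_topspace] open_or_closed_subset_topspace[OF assms(2)]] .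
  then show ?thesis using assms(1) by (simp add: DTM_def order_le_less_trans)
qed

lemma DTM_inner_approx:
  assumes "\<nu> \<in> DTM X" "openin X U" "0 < e"
  shows "\<exists>C. compactin X C \<and> C \<subseteq> U \<and> \<nu> U \<le> \<nu> C + ennreal e"
proof -
  have "{C. compactin X C \<and> C \<subseteq> U} \<noteq> {}" by (auto intro: exI[of _ "{}"])
  moreover have "\<nu> U \<noteq> \<infinity>" using DTM_finite[OF assms(1) openin_open_or_closed[OF assms(2)]] by simp
  ultimately have "\<exists>C\<in>{C. compactin X C \<and> C \<subseteq> U}. \<nu> U < \<nu> C + ennreal e"
    by (intro SUP_approx_ennreal[OF assms(3) _ DTM_inner[OF assms(1,2)]])
  then show ?thesis by (auto intro: less_imp_le)
qed

lemma DTM_outer_approx: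
  assumes "\<nu> \<in> DTM X" "closedin X F" "0 < e"
  shows "\<exists>U. openin X U \<and> F \<subseteq> U \<and> \<nu> U \<le> \<nu> F + ennreal e"
proof -
  have "\<nu> F \<noteq> \<infinity>" using DTM_finite[OF assms(1) closedin_open_or_closed[OF assms(2)]] by simp
  then have "\<exists>U\<in>{U. openin X U \<and> F \<subseteq> U}. \<nu> U < \<nu> F + ennreal e"
    by (intro INF_approx_ennreal[OF assms(3) DTM_outer[OF assms(1,2)]])
  then show ?thesis by (auto intro: less_imp_le)
qed

lemma DTM_I:
  assumes X: "Hausdorff_space X" and ext: "\<nu> \<in> extensional (open_or_closed_sets X)"
    and mono: "\<And>A B. A \<in> open_or_closed_sets X \<Longrightarrow> B \<in> open_or_closed_sets X \<Longrightarrow> A \<subseteq> B \<Longrightarrow> \<nu> A \<le> \<nu> B"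
    and fin: "\<nu> (topspace X) < \<infinity>"
    and add: "\<And>C K. compactin X C \<Longrightarrow> compactin X K \<Longrightarrow> C \<inter> K = {} \<Longrightarrow> \<nu> (C \<union> K) = \<nu> C + \<nu> K"
    and inner: "\<And>U e. openin X U \<Longrightarrow> 0 < e \<Longrightarrow> \<exists>C. compactin X C \<and> C \<subseteq> U \<and> \<nu> U \<le> \<nu> C + ennreal e"
    and outer: "\<And>F e. closedin X F \<Longrightarrow> 0 < e \<Longrightarrow> \<exists>U. openin X U \<and> F \<subseteq> U \<and> \<nu> U \<le> \<nu> F + ennreal e"
  shows "\<nu> \<in> DTM X"
proof -
  have "inner_regular_on_open X \<nu>"
    unfolding inner_regular_on_open_def
  proof (intro allI impI antisym)
    fix U assume U: "openin X U"
    show "(SUP C\<in>{C. compactin X C \<and> C \<subseteq> U}. \<nu> C) \<le> \<nu> U"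
      by (intro SUP_least mono) (use U X in \<open>auto simp: openin_open_or_closed compactin_open_or_closed\<close>)
    show "\<nu> U \<le> (SUP C\<in>{C. compactin X C \<and> C \<subseteq> U}. \<nu> C)"
    proof (rule ennreal_le_epsilon)
      fix e :: real assume "0 < e"
      then obtain C where C: "compactin X C" "C \<subseteq> U" "\<nu> U \<le> \<nu> C + ennreal e" using inner[OF U] by blast
      have "\<nu> C \<le> (SUP C\<in>{C. compactin X C \<and> C \<subseteq> U}. \<nu> C)" using C by (intro SUP_upper) auto
      with C(3) show "\<nu> U \<le> (SUP C\<in>{C. compactin X C \<and> C \<subseteq> U}. \<nu> C) + ennreal e"
        by (meson add_right_mono order_trans)
    qed
  qed
  moreover have "outer_regular_on_closed X \<nu>"
    unfolding outer_regular_on_closed_def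
  proof (intro allI impI antisym)
    fix F assume F: "closedin X F"
    show "\<nu> F \<le> (INF U\<in>{U. openin X U \<and> F \<subseteq> U}. \<nu> U)"
      by (intro INF_greatest mono) (use F in \<open>auto simp: openin_open_or_closed closedin_open_or_closed\<close>)
    show "(INF U\<in>{U. openin X U \<and> F \<subseteq> U}. \<nu> U) \<le> \<nu> F"
    proof (rule ennreal_le_epsilon)
      fix e :: real assume "0 < e"
      then obtain U where U: "openin X U" "F \<subseteq> U" "\<nu> U \<le> \<nu> F + ennreal e" using outer[OF F] by blast
      have "(INF U\<in>{U. openin X U \<and> F \<subseteq> U}. \<nu> U) \<le> \<nu> U" using U by (intro INF_lower) auto
      with U(3) show "(INF U\<in>{U. openin X U \<and> F \<subseteq> U}. \<nu> U) \<le> \<nu> F + ennreal e" by (rule order_trans[rotated])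
    qed
  qed
  moreover have "\<exists>A\<in>open_or_closed_sets X. \<nu> A \<noteq> \<infinity>"
    using fin by (intro bexI[of _ "topspace X"]) (auto simp: openin_open_or_closed)
  ultimately show ?thesis
    using ext fin add unfolding DTM_def deficient_topological_measure_def disjnt_def by blast
qed

lemma TM_iff_DTM_additive:
  "\<mu> \<in> TM X \<longleftrightarrow> \<mu> \<in> DTM X \<and>
    (\<forall>A B. (\<forall>D\<in>{A, B, A \<union> B}. compactin X D \<or> openin X D) \<and> disjnt A B \<longrightarrow> \<mu> (A \<union> B) = \<mu> A + \<mu> B)"
proof
  assume "\<mu> \<in> TM X"
  then show "\<mu> \<in> DTM X \<and>
    (\<forall>A B. (\<forall>D\<in>{A, B, A \<union> B}. compactin X D \<or> openin X D) \<and> disjnt A B \<longrightarrow> \<mu> (A \<union> B) = \<mu> A + \<mu> B)"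
    using TM_subset_DTM unfolding TM_def topological_measure_def by blast
qed (simp add: TM_def DTM_def topological_measure_def deficient_topological_measure_def)

text \<open>For compact \<open>F\<close>, approximate \<open>U - F\<close> from inside by compact sets and use additivity. For closed \<open>F\<close>,
approximate \<open>U - F\<close> by a compact set \<open>K\<close> and apply the compact case to \<open>K\<close>.\<close>

lemma DTM_superadditive:
  assumes X: "Hausdorff_space X" and \<nu>: "\<nu> \<in> DTM X"
    and F: "closedin X F" and U: "openin X U" "F \<subseteq> U"
  shows "\<nu> F + \<nu> (U - F) \<le> \<nu> U"
proof -
  have compact_case: "\<nu> K + \<nu> (V - K) \<le> \<nu> V" if K: "compactin X K" "K \<subseteq> V" and V: "openin X V" for K V
  proof (rule ennreal_le_epsilon)
    fix e :: real assume e: "0 < e"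
    have op: "openin X (V - K)" using V compactin_imp_closedin[OF X K(1)] by blast
    obtain C where C: "compactin X C" "C \<subseteq> V - K" "\<nu> (V - K) \<le> \<nu> C + ennreal e"
      using DTM_inner_approx[OF \<nu> op e] by blast
    have "\<nu> K + \<nu> (V - K) \<le> \<nu> K + \<nu> C + ennreal e" using C(3) by (simp add: add.assoc add_left_mono)
    also have "\<nu> K + \<nu> C = \<nu> (K \<union> C)" using C(2) by (intro DTM_add[OF \<nu> K(1) C(1), symmetric]) auto
    also have "\<dots> \<le> \<nu> V"
      using DTM_mono[OF \<nu> compactin_open_or_closed[OF X compactin_Un[OF K(1) C(1)]] openin_open_or_closed[OF V]]
        C(2) K(2) by blast
    finally show "\<nu> K + \<nu> (V - K) \<le> \<nu> V + ennreal e" by (simp add: add_right_mono)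
  qed
  show ?thesis
  proof (rule ennreal_le_epsilon)
    fix e :: real assume e: "0 < e"
    have op: "openin X (U - F)" using U F by blast
    obtain K where K: "compactin X K" "K \<subseteq> U - F" "\<nu> (U - F) \<le> \<nu> K + ennreal e"
      using DTM_inner_approx[OF \<nu> op e] by blast
    have op': "openin X (U - K)" using U(1) compactin_imp_closedin[OF X K(1)] by blast
    have "\<nu> F \<le> \<nu> (U - K)"
      using DTM_mono[OF \<nu> closedin_open_or_closed[OF F] openin_open_or_closed[OF op']] K(2) U(2) by blast
    then have "\<nu> F + \<nu> (U - F) \<le> \<nu> (U - K) + (\<nu> K + ennreal e)" using K(3) by (rule add_mono)
    also have "\<dots> = (\<nu> K + \<nu> (U - K)) + ennreal e" by (simp add: ac_simps)
    also have "\<dots> \<le> \<nu> U + ennreal e" using compact_case[OF K(1) _ U(1)] K(2) by (intro add_right_mono) auto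
    finally show "\<nu> F + \<nu> (U - F) \<le> \<nu> U + ennreal e" .
  qed
qed

section \<open>The greatest Radon measure below a deficient topological measure\<close>

text \<open>The Caratheodory construction applied to \<open>\<nu>\<close> on open sets. A measure below \<open>\<nu>\<close> on open sets is below
the sum over every such cover; this makes the result the greatest measure below \<open>\<nu>\<close>.\<close>

definition open_cover_outer_measure :: "'a topology \<Rightarrow> ('a set \<Rightarrow> ennreal) \<Rightarrow> 'a set \<Rightarrow> ennreal" where
  "open_cover_outer_measure X \<nu> E =
     (INF U\<in>{U :: nat \<Rightarrow> 'a set. (\<forall>i. openin X (U i)) \<and> E \<subseteq> (\<Union>i. U i)}. \<Sum>i. \<nu> (U i))"

lemma open_cover_outer_measure_le:
  "(\<And>i. openin X (U i)) \<Longrightarrow> E \<subseteq> (\<Union>i. U i) \<Longrightarrow> open_cover_outer_measure X \<nu> E \<le> (\<Sum>i. \<nu> (U i))"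
  unfolding open_cover_outer_measure_def by (intro INF_lower) auto

lemma open_cover_outer_measure_mono:
  "E \<subseteq> E' \<Longrightarrow> open_cover_outer_measure X \<nu> E \<le> open_cover_outer_measure X \<nu> E'"
  unfolding open_cover_outer_measure_def by (intro INF_superset_mono) auto

lemma open_cover_outer_measure_close:
  assumes "open_cover_outer_measure X \<nu> E < b"
  obtains U :: "nat \<Rightarrow> 'a set" where "\<And>i. openin X (U i)" "E \<subseteq> (\<Union>i. U i)" "(\<Sum>i. \<nu> (U i)) < b"
  using assms unfolding open_cover_outer_measure_def INF_less_iff by blast

lemma open_cover_outer_measure_openin_le:
  assumes \<nu>: "\<nu> \<in> DTM X" and U: "openin X U"
  shows "open_cover_outer_measure X \<nu> U \<le> \<nu> U"
proof -
  have "open_cover_outer_measure X \<nu> U \<le> (\<Sum>i. \<nu> (if i = (0::nat) then U else {}))"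
    using U by (intro open_cover_outer_measure_le) (auto split: if_splits)
  also have "\<dots> = (\<Sum>i\<in>{0}. \<nu> (if i = (0::nat) then U else {}))"
    by (rule suminf_finite) (auto simp: DTM_empty[OF \<nu>])
  finally show ?thesis by simp
qed

lemma open_cover_outer_measure_UN:
  fixes A :: "nat \<Rightarrow> 'a set"
  shows "open_cover_outer_measure X \<nu> (\<Union>i. A i) \<le> (\<Sum>n. open_cover_outer_measure X \<nu> (A n))"
proof (rule ennreal_le_epsilon)
  fix e :: real assume e: "0 < e" and fin: "(\<Sum>n. open_cover_outer_measure X \<nu> (A n)) < top"
  then have *: "open_cover_outer_measure X \<nu> (A n) < open_cover_outer_measure X \<nu> (A n) + e * (1/2)^Suc n" for n
    by (auto simp add: less_top dest!: ennreal_suminf_lessD)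
  have "\<exists>B. (\<forall>i. openin X (B i)) \<and> A n \<subseteq> (\<Union>i::nat. B i) \<and> (\<Sum>i. \<nu> (B i)) \<le> open_cover_outer_measure X \<nu> (A n) + e * (1/2)^Suc n" for n
    using open_cover_outer_measure_close[OF *[of n]] less_imp_le by metis
  then obtain B where B: "\<And>n i. openin X (B n i)" "\<And>n. A n \<subseteq> (\<Union>i::nat. B n i)"
    "\<And>n. (\<Sum>i. \<nu> (B n i)) \<le> open_cover_outer_measure X \<nu> (A n) + e * (1/2)^Suc n" by metis
  define C where "C k = B (fst (prod_decode k)) (snd (prod_decode k))" for k
  have "open_cover_outer_measure X \<nu> (\<Union>i. A i) \<le> (\<Sum>k. \<nu> (C k))"
  proof (rule open_cover_outer_measure_le)
    show "openin X (C i)" for i using B(1) by (simp add: C_def)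
    show "(\<Union>i. A i) \<subseteq> (\<Union>i. C i)"
    proof clarify
      fix x n assume "x \<in> A n"
      then obtain i where "x \<in> B n i" using B(2) by blast
      then have "x \<in> C (prod_encode (n, i))" by (simp add: C_def)
      then show "x \<in> (\<Union>i. C i)" by blast
    qed
  qed
  also have "\<dots> = (\<Sum>n. \<Sum>i. \<nu> (B n i))"
    using suminf_ennreal_2dimen[of "\<lambda>n. \<Sum>i. \<nu> (B n i)" "\<lambda>p. \<nu> (B (fst p) (snd p))"]
    by (simp add: C_def)
  also have "\<dots> \<le> (\<Sum>n. open_cover_outer_measure X \<nu> (A n) + e * (1/2) ^ Suc n)"
    by (intro suminf_le allI B) auto
  also have "\<dots> = (\<Sum>n. open_cover_outer_measure X \<nu> (A n)) + (\<Sum>n. ennreal e * ennreal ((1/2) ^ Suc n))"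
    using e by (subst suminf_add[symmetric])
      (auto simp del: ennreal_suminf_cmult simp add: ennreal_mult[symmetric])
  also have "\<dots> = (\<Sum>n. open_cover_outer_measure X \<nu> (A n)) + e"
    unfolding ennreal_suminf_cmult
    by (subst suminf_ennreal_eq[OF zero_le_power power_half_series]) auto
  finally show "open_cover_outer_measure X \<nu> (\<Union>i. A i) \<le> (\<Sum>n. open_cover_outer_measure X \<nu> (A n)) + e" .
qed

lemma outer_measure_space_open_cover:
  assumes \<nu>: "\<nu> \<in> DTM X"
  shows "outer_measure_space (Pow (topspace X)) (open_cover_outer_measure X \<nu>)"
proof -
  let ?O = "open_cover_outer_measure X \<nu>"
  have "positive (Pow (topspace X)) ?O"
    using open_cover_outer_measure_openin_le[OF \<nu>, of "{}"] DTM_empty[OF \<nu>] by (simp add: positive_def)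
  moreover have "increasing (Pow (topspace X)) ?O"
    by (simp add: increasing_def open_cover_outer_measure_mono)
  moreover have "countably_subadditive (Pow (topspace X)) ?O"
    unfolding countably_subadditive_def using open_cover_outer_measure_UN by blast
  ultimately show ?thesis by (simp add: outer_measure_space_def)
qed

text \<open>It suffices to split an open set \<open>U\<close>. For a compact \<open>C\<close> that almost exhausts \<open>U \<inter> G\<close>, superadditivity
bounds the values at \<open>U \<inter> G\<close> and \<open>U - G\<close> by \<open>\<nu> C + \<nu> (U - C) \<le> \<nu> U\<close>, up to an error. Superadditivity
of \<open>\<nu>\<close> thus suffices for measurability, although \<open>\<nu>\<close> may fail to be subadditive.\<close>

lemma openin_open_cover_measurable:
  assumes X: "Hausdorff_space X" and \<nu>: "\<nu> \<in> DTM X" and G: "openin X G"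
  shows "G \<in> lambda_system (topspace X) (Pow (topspace X)) (open_cover_outer_measure X \<nu>)"
proof -
  let ?O = "open_cover_outer_measure X \<nu>"
  have split: "?O (U \<inter> G) + ?O (U - G) \<le> \<nu> U" if U: "openin X U" for U
  proof (rule ennreal_le_epsilon)
    fix e :: real assume e: "0 < e"
    have UG: "openin X (U \<inter> G)" using U G by blast
    obtain C where C: "compactin X C" "C \<subseteq> U \<inter> G" "\<nu> (U \<inter> G) \<le> \<nu> C + ennreal e"
      using DTM_inner_approx[OF \<nu> UG e] by blast
    have clC: "closedin X C" using compactin_imp_closedin[OF X C(1)] .
    have UC: "openin X (U - C)" using U clC by blast
    have "?O (U \<inter> G) \<le> \<nu> C + ennreal e"
      using open_cover_outer_measure_openin_le[OF \<nu> UG] C(3) by (rule order_trans)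
    moreover have "?O (U - G) \<le> ?O (U - C)" using C(2) by (intro open_cover_outer_measure_mono) blast
    then have "?O (U - G) \<le> \<nu> (U - C)"
      using open_cover_outer_measure_openin_le[OF \<nu> UC] by (rule order_trans)
    ultimately have "?O (U \<inter> G) + ?O (U - G) \<le> (\<nu> C + ennreal e) + \<nu> (U - C)" by (rule add_mono)
    also have "\<dots> = (\<nu> C + \<nu> (U - C)) + ennreal e" by (simp add: ac_simps)
    also have "\<dots> \<le> \<nu> U + ennreal e"
      using DTM_superadditive[OF X \<nu> clC U] C(2) by (intro add_right_mono) auto
    finally show "?O (U \<inter> G) + ?O (U - G) \<le> \<nu> U + ennreal e" .
  qed
  interpret sigma_algebra "topspace X" "Pow (topspace X)" by (rule sigma_algebra_Pow)
  have sub: "subadditive (Pow (topspace X)) ?O"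
    using outer_measure_space_open_cover[OF \<nu>]
    by (intro countably_subadditive_subadditive) (auto simp: outer_measure_space_def)
  have "?O (E \<inter> G) + ?O (E - G) = ?O E" if E: "E \<subseteq> topspace X" for E
  proof (rule antisym)
    have "?O ((E \<inter> G) \<union> (E - G)) \<le> ?O (E \<inter> G) + ?O (E - G)"
      using E by (intro subadditiveD[OF sub]) auto
    then show "?O E \<le> ?O (E \<inter> G) + ?O (E - G)" by (simp add: Int_Diff_Un)
    show "?O (E \<inter> G) + ?O (E - G) \<le> ?O E"
      unfolding open_cover_outer_measure_def[of X \<nu> E]
    proof (rule INF_greatest)
      fix U :: "nat \<Rightarrow> 'a set" assume U: "U \<in> {U. (\<forall>i. openin X (U i)) \<and> E \<subseteq> (\<Union>i. U i)}"
      have "?O (E \<inter> G) \<le> ?O (\<Union>i. U i \<inter> G)" "?O (E - G) \<le> ?O (\<Union>i. U i - G)"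
        by (intro open_cover_outer_measure_mono, use U in blast)+
      then have "?O (E \<inter> G) + ?O (E - G) \<le> (\<Sum>i. ?O (U i \<inter> G)) + (\<Sum>i. ?O (U i - G))"
        by (intro add_mono order_trans[OF _ open_cover_outer_measure_UN])
      also have "\<dots> = (\<Sum>i. ?O (U i \<inter> G) + ?O (U i - G))" by (rule suminf_add) auto
      also have "\<dots> \<le> (\<Sum>i. \<nu> (U i))" using U split by (intro suminf_le) auto
      finally show "?O (E \<inter> G) + ?O (E - G) \<le> (\<Sum>i. \<nu> (U i))" .
    qed
  qed
  then show ?thesis using openin_subset[OF G] by (simp add: lambda_system_eq)
qed

lemma borel_closedin: "closedin X F \<Longrightarrow> F \<in> sets (sigma (topspace X) {U. openin X U})"
proof -
  assume F: "closedin X F"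
  have "{U. openin X U} \<subseteq> Pow (topspace X)" using openin_subset by blast
  moreover have "topspace X - F \<in> sigma_sets (topspace X) {U. openin X U}" using F by blast
  then have "topspace X - (topspace X - F) \<in> sigma_sets (topspace X) {U. openin X U}"
    by (rule sigma_sets.Compl)
  ultimately show ?thesis using closedin_subset[OF F] by (simp add: double_diff)
qed

lemma borel_openin: "openin X U \<Longrightarrow> U \<in> sets (sigma (topspace X) {U. openin X U})"
  using openin_subset by (subst sets_measure_of) (auto intro: sigma_sets.Basic)

text \<open>The last property expresses that \<open>m\<close> is the greatest: for a measure \<open>s\<close> on the same sets with \<open>s U \<le> \<nu> U\<close>
for all open \<open>U\<close>, countable subadditivity gives \<open>s B \<le> m B\<close>. Inner regularity of \<open>m\<close> on an open set \<open>U\<close>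
is inherited from \<open>\<nu>\<close>, as \<open>m (U - C) \<le> \<nu> (U - C) \<le> \<nu> U - \<nu> C\<close> for compact \<open>C \<subseteq> U\<close>.\<close>

lemma greatest_Radon_measure_below_DTM:
  assumes X: "Hausdorff_space X" and \<nu>: "\<nu> \<in> DTM X"
  obtains m where "radon_measure X m" "\<And>A. A \<in> open_or_closed_sets X \<Longrightarrow> emeasure m A \<le> \<nu> A"
    "\<And>B e. B \<in> sets m \<Longrightarrow> 0 < e \<Longrightarrow>
       \<exists>U :: nat \<Rightarrow> 'a set. (\<forall>i. openin X (U i)) \<and> B \<subseteq> (\<Union>i. U i) \<and> (\<Sum>i. \<nu> (U i)) \<le> emeasure m B + ennreal e"
proof -
  let ?O = "open_cover_outer_measure X \<nu>" and ?T = "topspace X"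
  let ?B = "sigma_sets ?T {U. openin X U}"
  have Pow: "{U. openin X U} \<subseteq> Pow ?T" using openin_subset by blast
  define m where "m = measure_of ?T ?B ?O"
  have ms: "measure_space ?T (lambda_system ?T (Pow ?T) ?O) ?O"
    using sigma_algebra.caratheodory_lemma[OF sigma_algebra_Pow outer_measure_space_open_cover[OF \<nu>]] .
  then have "sigma_algebra ?T (lambda_system ?T (Pow ?T) ?O)" by (simp add: measure_space_def)
  then have "?B \<subseteq> lambda_system ?T (Pow ?T) ?O"
    using openin_open_cover_measurable[OF X \<nu>] by (intro sigma_algebra.sigma_sets_subset) auto
  then have msB: "measure_space ?T ?B ?O"
    using measure_down[OF ms sigma_algebra_sigma_sets[OF Pow]] by blast
  have BPow: "?B \<subseteq> Pow ?T" using sigma_sets_into_sp[OF Pow] by blast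
  have sets_m: "sets m = ?B" unfolding m_def using BPow by (simp add: sigma_sets_sigma_sets_eq[OF Pow])
  have sets_m': "sets m = sets (sigma ?T {U. openin X U})" using sets_m Pow by simp
  have em: "emeasure m A = ?O A" if "A \<in> ?B" for A
    unfolding m_def using msB that by (intro emeasure_measure_of_sigma) (auto simp: measure_space_def)
  have opB: "U \<in> ?B" if "openin X U" for U using that by (auto intro: sigma_sets.Basic)
  have le_open: "emeasure m U \<le> \<nu> U" if "openin X U" for U
    using open_cover_outer_measure_openin_le[OF \<nu> that] em[OF opB[OF that]] by simp
  have clB: "F \<in> ?B" if "closedin X F" for F
    using borel_closedin[OF that] Pow by simp
  have le: "emeasure m A \<le> \<nu> A" if A: "A \<in> open_or_closed_sets X" for A
  proof (cases "openin X A")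
    case False
    then have F: "closedin X A" using A by (auto simp: open_or_closed_sets_def)
    show ?thesis
      unfolding DTM_outer[OF \<nu> F]
    proof (rule INF_greatest)
      fix U assume U: "U \<in> {U. openin X U \<and> A \<subseteq> U}"
      then have "emeasure m A \<le> emeasure m U" using opB sets_m by (intro emeasure_mono) auto
      also have "\<dots> \<le> \<nu> U" using U le_open by blast
      finally show "emeasure m A \<le> \<nu> U" .
    qed
  qed (rule le_open)
  have fin: "emeasure m A < \<infinity>" if "A \<in> sets m" for A
  proof -
    have "emeasure m A \<le> emeasure m ?T" using that opB[OF openin_topspace] sets_m BPow
      by (intro emeasure_mono) auto
    also have "\<dots> \<le> \<nu> ?T" by (rule le_open) simp
    also have "\<dots> < \<infinity>" using \<nu> by (simp add: DTM_def)
    finally show ?thesis .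
  qed
  have cover: "\<exists>U :: nat \<Rightarrow> 'a set. (\<forall>i. openin X (U i)) \<and> B \<subseteq> (\<Union>i. U i) \<and> (\<Sum>i. \<nu> (U i)) \<le> emeasure m B + ennreal e"
    if B: "B \<in> sets m" and e: "0 < e" for B and e :: real
  proof -
    have "?O B < emeasure m B + ennreal e"
      using em[of B] B sets_m fin[OF B] e
      by (cases "emeasure m B" rule: ennreal_cases) (auto simp: ennreal_less_iff simp flip: ennreal_plus)
    then show ?thesis
      by (rule open_cover_outer_measure_close) (blast intro: less_imp_le)
  qed
  have "radon_measure X m"
    unfolding radon_measure_def
  proof (intro conjI allI impI ballI)
    show "sets m = sets (sigma ?T {U. openin X U})" by (rule sets_m')
    show "emeasure m K < \<infinity>" if "compactin X K" for K
      using fin clB[OF compactin_imp_closedin[OF X that]] sets_m by blast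
    show "emeasure m B = (INF U\<in>{U. openin X U \<and> B \<subseteq> U}. emeasure m U)" if B: "B \<in> sets m" for B
    proof (rule antisym)
      show "emeasure m B \<le> (INF U\<in>{U. openin X U \<and> B \<subseteq> U}. emeasure m U)"
        using opB sets_m by (intro INF_greatest emeasure_mono) auto
      show "(INF U\<in>{U. openin X U \<and> B \<subseteq> U}. emeasure m U) \<le> emeasure m B"
      proof (rule ennreal_le_epsilon)
        fix e :: real assume "0 < e"
        from cover[OF B this] obtain U :: "nat \<Rightarrow> 'a set" where
          U: "\<And>i. openin X (U i)" "B \<subseteq> (\<Union>i. U i)" "(\<Sum>i. \<nu> (U i)) \<le> emeasure m B + ennreal e" by blast
        have UU: "openin X (\<Union>i. U i)" using U(1) by (intro openin_Union) auto
        have "(INF U\<in>{U. openin X U \<and> B \<subseteq> U}. emeasure m U) \<le> emeasure m (\<Union>i. U i)"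
          using UU U(2) by (intro INF_lower) auto
        also have "\<dots> \<le> (\<Sum>i. \<nu> (U i))"
          using em[OF opB[OF UU]] open_cover_outer_measure_le[of X U "\<Union>i. U i" \<nu>] U(1) by simp
        also note U(3)
        finally show "(INF U\<in>{U. openin X U \<and> B \<subseteq> U}. emeasure m U) \<le> emeasure m B + ennreal e" .
      qed
    qed
    show "emeasure m U = (SUP K\<in>{K. compactin X K \<and> K \<subseteq> U}. emeasure m K)" if U: "openin X U" for U
    proof (rule antisym)
      show "(SUP K\<in>{K. compactin X K \<and> K \<subseteq> U}. emeasure m K) \<le> emeasure m U"
        using opB[OF U] sets_m by (intro SUP_least emeasure_mono) auto
      show "emeasure m U \<le> (SUP K\<in>{K. compactin X K \<and> K \<subseteq> U}. emeasure m K)"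
      proof (rule ennreal_le_epsilon)
        fix e :: real assume "0 < e"
        from DTM_inner_approx[OF \<nu> U this] obtain C where
          C: "compactin X C" "C \<subseteq> U" "\<nu> U \<le> \<nu> C + ennreal e" by blast
        have cl: "closedin X C" using compactin_imp_closedin[OF X C(1)] .
        have UC: "openin X (U - C)" using U cl by blast
        have "\<nu> C + \<nu> (U - C) \<le> \<nu> C + ennreal e"
          using DTM_superadditive[OF X \<nu> cl U C(2)] C(3) by (rule order_trans)
        then have "\<nu> (U - C) \<le> ennreal e"
          using DTM_finite[OF \<nu> closedin_open_or_closed[OF cl]] by (auto simp: ennreal_add_left_cancel_le)
        then have small: "emeasure m (U - C) \<le> ennreal e" using le_open[OF UC] by (rule order_trans[rotated])
        have "emeasure m (C \<union> (U - C)) = emeasure m C + emeasure m (U - C)"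
          using clB[OF cl] opB[OF UC] sets_m by (intro plus_emeasure[symmetric]) auto
        then have "emeasure m U = emeasure m C + emeasure m (U - C)"
          using C(2) by (simp add: Un_absorb1)
        also have "\<dots> \<le> (SUP K\<in>{K. compactin X K \<and> K \<subseteq> U}. emeasure m K) + ennreal e"
          using small C by (intro add_mono SUP_upper) auto
        finally show "emeasure m U \<le> (SUP K\<in>{K. compactin X K \<and> K \<subseteq> U}. emeasure m K) + ennreal e" .
      qed
    qed
  qed
  with that le cover show ?thesis by blast
qed

section \<open>Differences and linear combinations\<close>

lemma ennreal_diff_add_diff:
  fixes a b p q :: ennreal
  assumes "p \<le> a" "q \<le> b" "p < \<infinity>" "q < \<infinity>"
  shows "(a + b) - (p + q) = (a - p) + (b - q)"
proof -
  have "a + b = ((a - p) + (b - q)) + (p + q)"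
    using assms by (metis add.assoc add.left_commute diff_add_cancel_ennreal)
  then show ?thesis using assms by (metis ennreal_add_diff_cancel_right ennreal_add_eq_top infinity_ennreal_def less_irrefl)
qed

lemma radon_measure_sets: "radon_measure X m \<Longrightarrow> sets m = sets (sigma (topspace X) {U. openin X U})"
  by (simp add: radon_measure_def)

lemma radon_measure_borel: "radon_measure X m \<Longrightarrow> A \<in> open_or_closed_sets X \<Longrightarrow> A \<in> sets m"
  by (auto simp: radon_measure_sets open_or_closed_sets_def borel_openin borel_closedin)

text \<open>The point is monotonicity, since a difference of monotone functions need not be monotone. For a closed
set \<open>F\<close> in an open set \<open>U\<close> it is superadditivity:
\<open>m U - m F = m (U - F) \<le> \<nu> (U - F) \<le> \<nu> U - \<nu> F\<close>. The general case follows by regularity.\<close>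

lemma DTM_diff_dominated_measure:
  assumes X: "Hausdorff_space X" and \<nu>: "\<nu> \<in> DTM X" and m: "radon_measure X m"
    and le: "\<And>A. A \<in> open_or_closed_sets X \<Longrightarrow> emeasure m A \<le> \<nu> A"
  shows "restrict (\<lambda>A. \<nu> A - emeasure m A) (open_or_closed_sets X) \<in> DTM X"
proof -
  let ?oc = "open_or_closed_sets X"
  define \<rho> where "\<rho> A = \<nu> A - emeasure m A" for A
  have fin: "\<nu> A < \<infinity>" "emeasure m A < \<infinity>" if "A \<in> ?oc" for A
    using DTM_finite[OF \<nu> that] le[OF that] by auto
  have m_mono: "emeasure m A \<le> emeasure m B" if "A \<in> ?oc" "B \<in> ?oc" "A \<subseteq> B" for A B
    using that radon_measure_borel[OF m] by (intro emeasure_mono) auto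
  have cl_op: "\<rho> F \<le> \<rho> U" if F: "closedin X F" and U: "openin X U" "F \<subseteq> U" for F U
  proof -
    have UF: "openin X (U - F)" using F U by blast
    note oc = closedin_open_or_closed[OF F] openin_open_or_closed[OF U(1)] openin_open_or_closed[OF UF]
    have "emeasure m F + emeasure m (U - F) = emeasure m (F \<union> (U - F))"
      using oc radon_measure_borel[OF m] by (intro plus_emeasure) auto
    then have mU: "emeasure m U = emeasure m F + emeasure m (U - F)" using U(2) by (simp add: Un_absorb1)
    have "(\<nu> F - emeasure m F) + emeasure m U = \<nu> F + emeasure m (U - F)"
      unfolding mU using le[OF oc(1)] by (simp add: diff_add_cancel_ennreal flip: add.assoc)
    also have "\<dots> \<le> \<nu> F + \<nu> (U - F)" using le[OF oc(3)] by (rule add_left_mono)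
    also have "\<dots> \<le> \<nu> U" by (rule DTM_superadditive[OF X \<nu> F U])
    finally have "((\<nu> F - emeasure m F) + emeasure m U) - emeasure m U \<le> \<nu> U - emeasure m U"
      by (intro ennreal_minus_mono) auto
    then show ?thesis using fin(2)[OF oc(2)] by (simp add: \<rho>_def)
  qed
  have close: "\<rho> A \<le> \<rho> B + ennreal e"
    if A: "A \<in> ?oc" and B: "B \<in> ?oc" and "B \<subseteq> A \<or> A \<subseteq> B" and "\<nu> A \<le> \<nu> B + ennreal e" and mBA: "emeasure m B \<le> emeasure m A" for A B e
  proof -
    have "\<nu> A - emeasure m A \<le> (ennreal e + \<nu> B) - emeasure m B"
      using that by (intro ennreal_minus_mono) (auto simp: add.commute)
    also have "\<dots> \<le> ennreal e + (\<nu> B - emeasure m B)" by (rule add_diff_le_ennreal)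
    finally show ?thesis by (simp add: \<rho>_def add.commute)
  qed
  have inner: "\<exists>C. compactin X C \<and> C \<subseteq> U \<and> \<rho> U \<le> \<rho> C + ennreal e" if U: "openin X U" and e: "0 < e" for U e
  proof -
    obtain C where C: "compactin X C" "C \<subseteq> U" "\<nu> U \<le> \<nu> C + ennreal e" using DTM_inner_approx[OF \<nu> U e] by blast
    have oc: "U \<in> ?oc" "C \<in> ?oc" using U C X by (auto intro: openin_open_or_closed compactin_open_or_closed)
    show ?thesis using close[OF oc _ C(3) m_mono[OF oc(2,1) C(2)]] C by blast
  qed
  have outer: "\<exists>U. openin X U \<and> F \<subseteq> U \<and> \<rho> U \<le> \<rho> F + ennreal e" if F: "closedin X F" and e: "0 < e" for F e
  proof -
    obtain U where U: "openin X U" "F \<subseteq> U" "\<nu> U \<le> \<nu> F + ennreal e" using DTM_outer_approx[OF \<nu> F e] by blast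
    have oc: "U \<in> ?oc" "F \<in> ?oc" using U F by (auto intro: openin_open_or_closed closedin_open_or_closed)
    show ?thesis using close[OF oc _ U(3) m_mono[OF oc(2,1) U(2)]] U by blast
  qed
  (* Approximate A from inside by a closed set and B from outside by an open set. *)
  have mono: "\<rho> A \<le> \<rho> B" if A: "A \<in> ?oc" and B: "B \<in> ?oc" and AB: "A \<subseteq> B" for A B
  proof (rule ennreal_le_epsilon)
    fix e :: real assume e: "0 < e"
    obtain C where C: "closedin X C" "C \<subseteq> A" "\<rho> A \<le> \<rho> C + ennreal (e/2)"
    proof (cases "closedin X A")
      case False
      then have "openin X A" using A by (auto simp: open_or_closed_sets_def)
      then show ?thesis using inner[of A "e/2"] e compactin_imp_closedin[OF X] that by auto
    qed (use that in auto)
    obtain U where U: "openin X U" "B \<subseteq> U" "\<rho> U \<le> \<rho> B + ennreal (e/2)"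
    proof (cases "openin X B")
      case False
      then have "closedin X B" using B by (auto simp: open_or_closed_sets_def)
      then show ?thesis using outer[of B "e/2"] e that by auto
    qed (use that in auto)
    have "\<rho> C \<le> \<rho> U" using C U AB by (intro cl_op) auto
    then have "\<rho> A \<le> (\<rho> B + ennreal (e/2)) + ennreal (e/2)"
      using C(3) U(3) by (meson add_right_mono order_trans)
    also have "\<dots> = \<rho> B + ennreal e" using e by (simp add: add.assoc flip: ennreal_plus)
    finally show "\<rho> A \<le> \<rho> B + ennreal e" .
  qed
  let ?r = "restrict (\<lambda>A. \<nu> A - emeasure m A) ?oc"
  have r: "?r A = \<rho> A" if "A \<in> ?oc" for A using that by (simp add: \<rho>_def)
  have r_cp: "?r C = \<rho> C" if "compactin X C" for C using r compactin_open_or_closed[OF X that] .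
  have r_op: "?r U = \<rho> U" if "openin X U" for U using r openin_open_or_closed[OF that] .
  have r_cl: "?r F = \<rho> F" if "closedin X F" for F using r closedin_open_or_closed[OF that] .
  show ?thesis
  proof (rule DTM_I[OF X])
    have "\<rho> (topspace X) \<le> \<nu> (topspace X)" unfolding \<rho>_def by (rule diff_le_self_ennreal)
    then show "?r (topspace X) < \<infinity>"
      using fin(1)[OF openin_open_or_closed[OF openin_topspace]] r_op[OF openin_topspace] by auto
    show "?r (C \<union> K) = ?r C + ?r K" if C: "compactin X C" and K: "compactin X K" and "C \<inter> K = {}" for C K
    proof -
      note oc = compactin_open_or_closed[OF X C] compactin_open_or_closed[OF X K]
      have "emeasure m (C \<union> K) = emeasure m C + emeasure m K"
        using oc radon_measure_borel[OF m] that(3) by (intro plus_emeasure[symmetric]) auto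
      moreover have "\<nu> (C \<union> K) = \<nu> C + \<nu> K" using DTM_add[OF \<nu> C K that(3)] .
      ultimately show ?thesis
        unfolding r_cp[OF C] r_cp[OF K] r_cp[OF compactin_Un[OF C K]] \<rho>_def
        using ennreal_diff_add_diff[OF le[OF oc(1)] le[OF oc(2)]] fin oc by simp
    qed
    show "\<exists>C. compactin X C \<and> C \<subseteq> U \<and> ?r U \<le> ?r C + ennreal e" if "openin X U" "0 < e" for U e
      using inner[OF that] r_op[OF that(1)] r_cp by metis
    show "\<exists>U. openin X U \<and> F \<subseteq> U \<and> ?r U \<le> ?r F + ennreal e" if "closedin X F" "0 < e" for F e
      using outer[OF that] r_cl[OF that(1)] r_op by metis
    show "?r A \<le> ?r B" if "A \<in> ?oc" "B \<in> ?oc" "A \<subseteq> B" for A B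
      using mono[OF that] that by (simp add: \<rho>_def)
  qed simp
qed

lemma TM_diff_dominated_measure:
  assumes X: "Hausdorff_space X" and \<nu>: "\<nu> \<in> TM X" and m: "radon_measure X m"
    and le: "\<And>A. A \<in> open_or_closed_sets X \<Longrightarrow> emeasure m A \<le> \<nu> A"
  shows "restrict (\<lambda>A. \<nu> A - emeasure m A) (open_or_closed_sets X) \<in> TM X"
  unfolding TM_iff_DTM_additive
proof (intro conjI allI impI)
  let ?oc = "open_or_closed_sets X"
  let ?r = "restrict (\<lambda>A. \<nu> A - emeasure m A) ?oc"
  have \<nu>': "\<nu> \<in> DTM X" using \<nu> TM_subset_DTM by blast
  then show "?r \<in> DTM X" using DTM_diff_dominated_measure X m le by blast
  fix A B assume AB: "(\<forall>D\<in>{A, B, A \<union> B}. compactin X D \<or> openin X D) \<and> disjnt A B"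
  then have oc: "A \<in> ?oc" "B \<in> ?oc" "A \<union> B \<in> ?oc"
    using compactin_open_or_closed[OF X] openin_open_or_closed by blast+
  have "\<nu> (A \<union> B) = \<nu> A + \<nu> B" using \<nu> AB unfolding TM_iff_DTM_additive by blast
  moreover have "emeasure m (A \<union> B) = emeasure m A + emeasure m B"
    using oc radon_measure_borel[OF m] AB by (intro plus_emeasure[symmetric]) (auto simp: disjnt_def)
  moreover have "emeasure m D < \<infinity>" if "D \<in> ?oc" for D
    using DTM_finite[OF \<nu>' that] le[OF that] by auto
  ultimately show "?r (A \<union> B) = ?r A + ?r B"
    using ennreal_diff_add_diff[OF le[OF oc(1)] le[OF oc(2)]] oc by simp
qed

lemma DTM_add_scaled:
  assumes X: "Hausdorff_space X" and \<nu>: "\<nu> \<in> DTM X" and \<kappa>: "\<kappa> \<in> DTM X" and c: "0 \<le> c"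
  shows "restrict (\<lambda>A. \<nu> A + ennreal c * \<kappa> A) (open_or_closed_sets X) \<in> DTM X"
proof -
  let ?oc = "open_or_closed_sets X"
  let ?r = "restrict (\<lambda>A. \<nu> A + ennreal c * \<kappa> A) ?oc"
  have bound: "?r A \<le> ?r B + ennreal e"
    if "A \<in> ?oc" "B \<in> ?oc" and e: "0 < e"
      and \<nu>AB: "\<nu> A \<le> \<nu> B + ennreal (e/2)" and \<kappa>AB: "\<kappa> A \<le> \<kappa> B + ennreal (e / (2 * (c + 1)))" for A B e
  proof -
    have "c * (e / (2 * (c + 1))) \<le> e / 2" using c e by (simp add: field_simps)
    then have small: "ennreal c * ennreal (e / (2 * (c + 1))) \<le> ennreal (e / 2)"
      using c e by (simp add: ennreal_leI flip: ennreal_mult)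
    have "\<nu> A + ennreal c * \<kappa> A \<le> (\<nu> B + ennreal (e/2)) + ennreal c * (\<kappa> B + ennreal (e / (2 * (c + 1))))"
      using \<nu>AB \<kappa>AB by (intro add_mono mult_left_mono) auto
    also have "\<dots> = (\<nu> B + ennreal c * \<kappa> B) + (ennreal (e/2) + ennreal c * ennreal (e / (2 * (c + 1))))"
      by (simp add: distrib_left ac_simps)
    also have "\<dots> \<le> (\<nu> B + ennreal c * \<kappa> B) + (ennreal (e/2) + ennreal (e/2))"
      using small by (intro add_left_mono)
    also have "\<dots> = (\<nu> B + ennreal c * \<kappa> B) + ennreal e" using e by (simp flip: ennreal_plus)
    finally show ?thesis using that by simp
  qed
  show ?thesis
  proof (rule DTM_I[OF X])
    show mono: "?r A \<le> ?r B" if "A \<in> ?oc" "B \<in> ?oc" "A \<subseteq> B" for A B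
      using DTM_mono[OF \<nu> that] DTM_mono[OF \<kappa> that] that by (auto intro!: add_mono mult_left_mono)
    show "?r (topspace X) < \<infinity>"
      using DTM_finite[OF \<nu>] DTM_finite[OF \<kappa>] openin_open_or_closed[OF openin_topspace[of X]]
      by (simp add: ennreal_mult_less_top)
    show "?r (C \<union> K) = ?r C + ?r K" if C: "compactin X C" and K: "compactin X K" and "C \<inter> K = {}" for C K
      using DTM_add[OF \<nu> that] DTM_add[OF \<kappa> that] compactin_open_or_closed[OF X C]
        compactin_open_or_closed[OF X K] compactin_open_or_closed[OF X compactin_Un[OF C K]]
      by (simp add: distrib_left ac_simps)
    show "\<exists>C. compactin X C \<and> C \<subseteq> U \<and> ?r U \<le> ?r C + ennreal e" if U: "openin X U" and e: "0 < e" for U e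
    proof -
      have e2: "0 < e/2" "0 < e / (2 * (c + 1))" using e c by auto
      obtain C where C: "compactin X C" "C \<subseteq> U" "\<nu> U \<le> \<nu> C + ennreal (e/2)"
        using DTM_inner_approx[OF \<nu> U e2(1)] by blast
      obtain K where K: "compactin X K" "K \<subseteq> U" "\<kappa> U \<le> \<kappa> K + ennreal (e / (2 * (c + 1)))"
        using DTM_inner_approx[OF \<kappa> U e2(2)] by blast
      have CK: "compactin X (C \<union> K)" using C K by (intro compactin_Un)
      note oc = compactin_open_or_closed[OF X C(1)] compactin_open_or_closed[OF X K(1)] compactin_open_or_closed[OF X CK]
      have "\<nu> U \<le> \<nu> (C \<union> K) + ennreal (e/2)"
        using C(3) DTM_mono[OF \<nu> oc(1,3)] by (meson Un_upper1 add_right_mono order_trans)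
      moreover have "\<kappa> U \<le> \<kappa> (C \<union> K) + ennreal (e / (2 * (c + 1)))"
        using K(3) DTM_mono[OF \<kappa> oc(2,3)] by (meson Un_upper2 add_right_mono order_trans)
      ultimately show ?thesis
        using bound[OF openin_open_or_closed[OF U] oc(3) e] CK C(2) K(2) by blast
    qed
    show "\<exists>U. openin X U \<and> F \<subseteq> U \<and> ?r U \<le> ?r F + ennreal e" if F: "closedin X F" and e: "0 < e" for F e
    proof -
      have e2: "0 < e/2" "0 < e / (2 * (c + 1))" using e c by auto
      obtain U where U: "openin X U" "F \<subseteq> U" "\<nu> U \<le> \<nu> F + ennreal (e/2)"
        using DTM_outer_approx[OF \<nu> F e2(1)] by blast
      obtain V where V: "openin X V" "F \<subseteq> V" "\<kappa> V \<le> \<kappa> F + ennreal (e / (2 * (c + 1)))"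
        using DTM_outer_approx[OF \<kappa> F e2(2)] by blast
      have UV: "openin X (U \<inter> V)" using U V by blast
      note oc = openin_open_or_closed[OF U(1)] openin_open_or_closed[OF V(1)] openin_open_or_closed[OF UV]
      have "\<nu> (U \<inter> V) \<le> \<nu> F + ennreal (e/2)"
        using U(3) DTM_mono[OF \<nu> oc(3,1)] by (meson Int_lower1 order_trans)
      moreover have "\<kappa> (U \<inter> V) \<le> \<kappa> F + ennreal (e / (2 * (c + 1)))"
        using V(3) DTM_mono[OF \<kappa> oc(3,2)] by (meson Int_lower2 order_trans)
      ultimately show ?thesis
        using bound[OF oc(3) closedin_open_or_closed[OF F] e] UV U(2) V(2) by blast
    qed
  qed simp
qed

lemma TM_add_scaled:
  assumes X: "Hausdorff_space X" and \<nu>: "\<nu> \<in> TM X" and \<kappa>: "\<kappa> \<in> TM X" and c: "0 \<le> c"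
  shows "restrict (\<lambda>A. \<nu> A + ennreal c * \<kappa> A) (open_or_closed_sets X) \<in> TM X"
  unfolding TM_iff_DTM_additive
proof (intro conjI allI impI)
  let ?oc = "open_or_closed_sets X"
  let ?r = "restrict (\<lambda>A. \<nu> A + ennreal c * \<kappa> A) ?oc"
  show "?r \<in> DTM X" using DTM_add_scaled[OF X _ _ c] \<nu> \<kappa> TM_subset_DTM by blast
  fix A B assume AB: "(\<forall>D\<in>{A, B, A \<union> B}. compactin X D \<or> openin X D) \<and> disjnt A B"
  then have oc: "A \<in> ?oc" "B \<in> ?oc" "A \<union> B \<in> ?oc"
    using compactin_open_or_closed[OF X] openin_open_or_closed by blast+
  have "\<nu> (A \<union> B) = \<nu> A + \<nu> B" "\<kappa> (A \<union> B) = \<kappa> A + \<kappa> B"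
    using \<nu> \<kappa> AB unfolding TM_iff_DTM_additive by blast+
  then show "?r (A \<union> B) = ?r A + ?r B" using oc by (simp add: distrib_left ac_simps)
qed

lemma zero_TM: "Hausdorff_space X \<Longrightarrow> restrict (\<lambda>A. 0) (open_or_closed_sets X) \<in> TM X"
  unfolding TM_iff_DTM_additive
proof (intro conjI allI impI)
  let ?oc = "open_or_closed_sets X"
  assume X: "Hausdorff_space X"
  have r: "restrict (\<lambda>A. 0) ?oc C = (0::ennreal)" if "compactin X C \<or> openin X C \<or> closedin X C" for C
    using that compactin_open_or_closed[OF X, of C] openin_open_or_closed[of X C] closedin_open_or_closed[of X C] by auto
  show "restrict (\<lambda>A. 0) ?oc \<in> DTM X"
  proof (rule DTM_I[OF X])
    show "\<exists>C. compactin X C \<and> C \<subseteq> U \<and> (restrict (\<lambda>A. 0) ?oc U :: ennreal) \<le> restrict (\<lambda>A. 0) ?oc C + ennreal e"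
      if "openin X U" for U e using that by (intro exI[of _ "{}"]) (simp add: r del: restrict_apply)
    show "\<exists>U. openin X U \<and> F \<subseteq> U \<and> (restrict (\<lambda>A. 0) ?oc U :: ennreal) \<le> restrict (\<lambda>A. 0) ?oc F + ennreal e"
      if "closedin X F" for F e using that closedin_subset[OF that] by (intro exI[of _ "topspace X"]) (simp add: r del: restrict_apply)
    show "(restrict (\<lambda>A. 0) ?oc A :: ennreal) \<le> restrict (\<lambda>A. 0) ?oc B" if "A \<in> ?oc" "B \<in> ?oc" for A B
      using that by simp
  qed (auto simp: r compactin_Un simp del: restrict_apply)
  fix A B assume "(\<forall>D\<in>{A, B, A \<union> B}. compactin X D \<or> openin X D) \<and> disjnt A B"
  then show "(restrict (\<lambda>A. 0) ?oc (A \<union> B) :: ennreal) = restrict (\<lambda>A. 0) ?oc A + restrict (\<lambda>A. 0) ?oc B"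
    by (auto simp: r simp del: restrict_apply)
qed

lemma TM_sum_scaled:
  assumes X: "Hausdorff_space X" and "finite I" and \<kappa>: "\<And>i. i \<in> I \<Longrightarrow> \<kappa> i \<in> TM X" and c: "\<And>i. i \<in> I \<Longrightarrow> 0 \<le> c i"
  shows "restrict (\<lambda>A. \<Sum>i\<in>I. ennreal (c i) * \<kappa> i A) (open_or_closed_sets X) \<in> TM X"
  using assms(2-)
proof (induction I rule: finite_induct)
  case empty
  then show ?case by (simp only: sum.empty zero_TM[OF X])
next
  case (insert j I)
  let ?oc = "open_or_closed_sets X"
  have "restrict (\<lambda>A. restrict (\<lambda>A. \<Sum>i\<in>I. ennreal (c i) * \<kappa> i A) ?oc A + ennreal (c j) * \<kappa> j A) ?oc \<in> TM X"
    using insert by (intro TM_add_scaled[OF X]) auto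
  moreover have "restrict (\<lambda>A. restrict (\<lambda>A. \<Sum>i\<in>I. ennreal (c i) * \<kappa> i A) ?oc A + ennreal (c j) * \<kappa> j A) ?oc
      = restrict (\<lambda>A. \<Sum>i\<in>insert j I. ennreal (c i) * \<kappa> i A) ?oc"
    using insert.hyps by (intro restrict_ext) (simp add: add.commute)
  ultimately show ?case by (simp only:)
qed

section \<open>Properness\<close>

lemma radon_measure_outer_approx:
  assumes "radon_measure X m" "B \<in> sets m" "emeasure m B < \<infinity>" "0 < e"
  shows "\<exists>U. openin X U \<and> B \<subseteq> U \<and> emeasure m U \<le> emeasure m B + ennreal e"
proof -
  have "emeasure m B = (INF U\<in>{U. openin X U \<and> B \<subseteq> U}. emeasure m U)"
    using assms(1,2) by (simp add: radon_measure_def)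
  then have "\<exists>U\<in>{U. openin X U \<and> B \<subseteq> U}. emeasure m U < emeasure m B + ennreal e"
    by (rule INF_approx_ennreal[OF assms(4)]) (use assms(3) in simp)
  then show ?thesis by (auto intro: less_imp_le)
qed

lemma radon_measure_inner_approx:
  assumes "radon_measure X m" "openin X U" "emeasure m U < \<infinity>" "0 < e"
  shows "\<exists>K. compactin X K \<and> K \<subseteq> U \<and> emeasure m U \<le> emeasure m K + ennreal e"
proof -
  have eq: "emeasure m U = (SUP K\<in>{K. compactin X K \<and> K \<subseteq> U}. emeasure m K)"
    using assms(1,2) by (simp add: radon_measure_def)
  have "{K. compactin X K \<and> K \<subseteq> U} \<noteq> {}" by (auto intro: exI[of _ "{}"])
  then have "\<exists>K\<in>{K. compactin X K \<and> K \<subseteq> U}. emeasure m U < emeasure m K + ennreal e"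
    by (rule SUP_approx_ennreal[OF assms(4) _ eq less_imp_neq[OF assms(3)]])
  then show ?thesis by (auto intro: less_imp_le)
qed

text \<open>Let \<open>r\<close> be a Radon measure below \<open>\<nu> - m + \<kappa>\<close>. On sets where \<open>\<kappa>\<close> vanishes, \<open>s = r + m\<close> is below \<open>\<nu>\<close>. A
compact set is covered by finitely many open \<open>\<kappa>\<close>-null sets, hence, up to small \<open>s\<close>-measure, it
contains a disjoint union of compact \<open>\<kappa>\<close>-null sets; additivity of \<open>\<nu>\<close> on disjoint compact sets
gives \<open>s \<le> \<nu>\<close> on compact sets, and then on open sets. But \<open>m\<close> is the greatest measure below \<open>\<nu>\<close>, so
\<open>r + m \<le> m\<close> and \<open>r = 0\<close>.\<close>

lemma proper_dtm_replace_greatest_Radon_measure: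
  assumes X: "Hausdorff_space X" and \<nu>: "\<nu> \<in> DTM X" and m: "radon_measure X m"
    and le: "\<And>A. A \<in> open_or_closed_sets X \<Longrightarrow> emeasure m A \<le> \<nu> A"
    and cover: "\<And>B e. B \<in> sets m \<Longrightarrow> 0 < e \<Longrightarrow>
       \<exists>U :: nat \<Rightarrow> 'a set. (\<forall>i. openin X (U i)) \<and> B \<subseteq> (\<Union>i. U i) \<and> (\<Sum>i. \<nu> (U i)) \<le> emeasure m B + ennreal e"
    and \<kappa>: "\<kappa> \<in> DTM X" and null: "\<And>x. x \<in> topspace X \<Longrightarrow> \<exists>U. openin X U \<and> x \<in> U \<and> \<kappa> U = 0"
    and \<nu>': "\<And>A. A \<in> open_or_closed_sets X \<Longrightarrow> \<nu>' A = \<nu> A - emeasure m A + \<kappa> A"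
  shows "proper_dtm X \<nu>'"
  unfolding proper_dtm_def
proof (intro allI impI ballI)
  fix r B assume r: "radon_measure X r \<and> (\<forall>A\<in>open_or_closed_sets X. emeasure r A \<le> \<nu>' A)" and B: "B \<in> sets r"
  let ?oc = "open_or_closed_sets X"
  have rr: "radon_measure X r" and r_le: "\<And>A. A \<in> ?oc \<Longrightarrow> emeasure r A \<le> \<nu>' A" using r by blast+
  define s where "s A = emeasure r A + emeasure m A" for A
  have fin: "\<nu> A < \<infinity>" "emeasure m A < \<infinity>" "emeasure r A < \<infinity>" if "A \<in> ?oc" for A
  proof -
    show "\<nu> A < \<infinity>" using DTM_finite[OF \<nu> that] .
    then show "emeasure m A < \<infinity>" using le[OF that] by auto
    have "\<nu> A - emeasure m A < \<infinity>"
      using diff_le_self_ennreal \<open>\<nu> A < \<infinity>\<close> by (rule order_le_less_trans)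
    then have "\<nu>' A < \<infinity>" using \<nu>'[OF that] DTM_finite[OF \<kappa> that] by auto
    then show "emeasure r A < \<infinity>" using r_le[OF that] by auto
  qed
  have sets: "A \<in> sets r" "A \<in> sets m" if "A \<in> ?oc" for A
    using radon_measure_borel[OF rr that] radon_measure_borel[OF m that] by auto
  have s_null: "s A \<le> \<nu> A" if A: "A \<in> ?oc" and "\<kappa> A = 0" for A
  proof -
    have "s A \<le> (\<nu> A - emeasure m A) + emeasure m A"
      unfolding s_def using r_le[OF A] \<nu>'[OF A] that(2) by (intro add_right_mono) simp
    then show ?thesis using le[OF A] by (simp add: diff_add_cancel_ennreal)
  qed
  have s_mono: "s A \<le> s A'" if "A' \<in> ?oc" "A \<subseteq> A'" for A A'
    unfolding s_def using sets[OF that(1)] that(2) by (intro add_mono emeasure_mono) auto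
  have s_outer: "\<exists>V. openin X V \<and> C \<subseteq> V \<and> s V \<le> s C + ennreal e" if C: "C \<in> ?oc" and e: "0 < e" for C e
  proof -
    have e2: "0 < e/2" using e by simp
    obtain V where V: "openin X V" "C \<subseteq> V" "emeasure r V \<le> emeasure r C + ennreal (e/2)"
      using radon_measure_outer_approx[OF rr sets(1)[OF C] fin(3)[OF C] e2] by blast
    obtain W where W: "openin X W" "C \<subseteq> W" "emeasure m W \<le> emeasure m C + ennreal (e/2)"
      using radon_measure_outer_approx[OF m sets(2)[OF C] fin(2)[OF C] e2] by blast
    have "emeasure r (V \<inter> W) \<le> emeasure r V" "emeasure m (V \<inter> W) \<le> emeasure m W"
      using sets[OF openin_open_or_closed[OF V(1)]] sets[OF openin_open_or_closed[OF W(1)]]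
      by (intro emeasure_mono; simp)+
    then have "s (V \<inter> W) \<le> (emeasure r C + ennreal (e/2)) + (emeasure m C + ennreal (e/2))"
      unfolding s_def using V(3) W(3) by (meson add_mono order_trans)
    also have "\<dots> = s C + (ennreal (e/2) + ennreal (e/2))" by (simp add: s_def ac_simps)
    also have "\<dots> = s C + ennreal e" using e by (simp flip: ennreal_plus)
    finally show ?thesis using V W by (intro exI[of _ "V \<inter> W"]) auto
  qed
  have s_finite_cover: "s C \<le> \<nu> C"
    if "finite \<U>" "\<And>U. U \<in> \<U> \<Longrightarrow> openin X U \<and> \<kappa> U = 0" "compactin X C" "C \<subseteq> \<Union>\<U>" for \<U> C
    using that
  proof (induction \<U> arbitrary: C rule: finite_induct)
    case empty
    then show ?case by (simp add: s_def)
  next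
    case (insert G \<U>)
    have G: "openin X G" "\<kappa> G = 0" using insert.prems(1) by auto
    show ?case
    proof (rule ennreal_le_epsilon)
      fix e :: real assume e: "0 < e"
      (* Split C into a part C - V inside the null set G and the compact part C - G, which lies in V;
         these two parts are disjoint, and s hardly charges V more than C - G. *)
      have CG: "compactin X (C - G)" using compactin_diff_openin[OF insert.prems(2) G(1)] .
      have IH: "s (C - G) \<le> \<nu> (C - G)" using insert.prems by (intro insert.IH CG) auto
      obtain V where V: "openin X V" "C - G \<subseteq> V" "s V \<le> s (C - G) + ennreal e"
        using s_outer[OF compactin_open_or_closed[OF X CG] e] by blast
      have K: "compactin X (C - V)" using compactin_diff_openin[OF insert.prems(2) V(1)] .
      note oc = compactin_open_or_closed[OF X CG] compactin_open_or_closed[OF X K] openin_open_or_closed[OF V(1)]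
        compactin_open_or_closed[OF X insert.prems(2)] openin_open_or_closed[OF G(1)]
      have "\<kappa> (C - V) \<le> \<kappa> G" using V(2) by (intro DTM_mono[OF \<kappa> oc(2,5)]) auto
      then have "s (C - V) \<le> \<nu> (C - V)" using G(2) by (intro s_null oc) auto
      have "s C \<le> s (C - V) + s V"
      proof -
        have "emeasure r C \<le> emeasure r ((C - V) \<union> V)" "emeasure m C \<le> emeasure m ((C - V) \<union> V)"
          using sets[OF oc(2)] sets[OF oc(3)] sets[OF oc(4)] by (intro emeasure_mono sets.Un; blast)+
        moreover have "emeasure r ((C - V) \<union> V) \<le> emeasure r (C - V) + emeasure r V"
          "emeasure m ((C - V) \<union> V) \<le> emeasure m (C - V) + emeasure m V"
          using sets[OF oc(2)] sets[OF oc(3)] by (intro emeasure_subadditive; auto)+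
        ultimately have "s C \<le> (emeasure r (C - V) + emeasure r V) + (emeasure m (C - V) + emeasure m V)"
          unfolding s_def by (meson add_mono order_trans)
        then show ?thesis by (simp add: s_def ac_simps)
      qed
      also have "\<dots> \<le> \<nu> (C - V) + (\<nu> (C - G) + ennreal e)"
        using \<open>s (C - V) \<le> \<nu> (C - V)\<close> V(3) IH by (meson add_mono add_right_mono order_trans)
      also have "\<dots> = (\<nu> (C - V) + \<nu> (C - G)) + ennreal e" by (simp add: ac_simps)
      also have "\<nu> (C - V) + \<nu> (C - G) = \<nu> ((C - V) \<union> (C - G))"
        using V(2) by (intro DTM_add[OF \<nu> K CG, symmetric]) auto
      also have "\<dots> \<le> \<nu> C"
        using compactin_open_or_closed[OF X compactin_Un[OF K CG]] by (intro DTM_mono[OF \<nu> _ oc(4)]) auto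
      finally show "s C \<le> \<nu> C + ennreal e" by (simp add: add_right_mono)
    qed
  qed
  have s_compact: "s C \<le> \<nu> C" if C: "compactin X C" for C
  proof -
    have "C \<subseteq> \<Union>{U. openin X U \<and> \<kappa> U = 0}" using null compactin_subset_topspace[OF C] by blast
    then obtain \<U> where "finite \<U>" "\<U> \<subseteq> {U. openin X U \<and> \<kappa> U = 0}" "C \<subseteq> \<Union>\<U>"
      using compactinD[OF C, of "{U. openin X U \<and> \<kappa> U = 0}"] by auto
    then show ?thesis using C by (intro s_finite_cover[of \<U>]) auto
  qed
  have s_open: "s U \<le> \<nu> U" if U: "openin X U" for U
  proof (rule ennreal_le_epsilon)
    fix e :: real assume e: "0 < e"
    then have e2: "0 < e/2" by simp
    note Uoc = openin_open_or_closed[OF U]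
    obtain C where C: "compactin X C" "C \<subseteq> U" "emeasure r U \<le> emeasure r C + ennreal (e/2)"
      using radon_measure_inner_approx[OF rr U fin(3)[OF Uoc] e2] by blast
    obtain K where K: "compactin X K" "K \<subseteq> U" "emeasure m U \<le> emeasure m K + ennreal (e/2)"
      using radon_measure_inner_approx[OF m U fin(2)[OF Uoc] e2] by blast
    have CK: "compactin X (C \<union> K)" using C K by (intro compactin_Un)
    note oc = compactin_open_or_closed[OF X CK]
    have "emeasure r C \<le> emeasure r (C \<union> K)" "emeasure m K \<le> emeasure m (C \<union> K)"
      using sets[OF oc] by (intro emeasure_mono; auto)+
    then have "s U \<le> (emeasure r (C \<union> K) + ennreal (e/2)) + (emeasure m (C \<union> K) + ennreal (e/2))"
      unfolding s_def using C(3) K(3) by (meson add_mono add_right_mono order_trans)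
    also have "\<dots> = s (C \<union> K) + (ennreal (e/2) + ennreal (e/2))" by (simp add: s_def ac_simps)
    also have "\<dots> = s (C \<union> K) + ennreal e" using e by (simp flip: ennreal_plus)
    also have "\<dots> \<le> \<nu> U + ennreal e"
      using s_compact[OF CK] DTM_mono[OF \<nu> oc Uoc] C(2) K(2) by (intro add_right_mono) (meson Un_least order_trans)
    finally show "s U \<le> \<nu> U + ennreal e" .
  qed
  have Bm: "B \<in> sets m" using B radon_measure_sets[OF rr] radon_measure_sets[OF m] by simp
  have "emeasure r B + emeasure m B \<le> emeasure m B"
  proof (rule ennreal_le_epsilon)
    fix e :: real assume e: "0 < e"
    obtain U :: "nat \<Rightarrow> 'a set" where U: "\<And>i. openin X (U i)" "B \<subseteq> (\<Union>i. U i)"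
      "(\<Sum>i. \<nu> (U i)) \<le> emeasure m B + ennreal e" using cover[OF Bm e] by blast
    have Us: "U i \<in> sets r" "U i \<in> sets m" for i using sets openin_open_or_closed[OF U(1)] by auto
    have "emeasure r B \<le> (\<Sum>i. emeasure r (U i))" "emeasure m B \<le> (\<Sum>i. emeasure m (U i))"
      using Us U(2) by (intro order_trans[OF emeasure_mono[of B "\<Union>i. U i"] emeasure_subadditive_countably]; auto)+
    then have "emeasure r B + emeasure m B \<le> (\<Sum>i. emeasure r (U i)) + (\<Sum>i. emeasure m (U i))"
      by (rule add_mono)
    also have "\<dots> = (\<Sum>i. s (U i))" unfolding s_def by (rule suminf_add) auto
    also have "\<dots> \<le> (\<Sum>i. \<nu> (U i))" using s_open[OF U(1)] by (intro suminf_le) auto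
    also note U(3)
    finally show "emeasure r B + emeasure m B \<le> emeasure m B + ennreal e" .
  qed
  moreover have "emeasure m B < \<infinity>"
  proof -
    have "space m = topspace X"
      using sets_eq_imp_space_eq[OF radon_measure_sets[OF m]] by (simp add: space_measure_of_conv)
    then have "emeasure m B \<le> emeasure m (topspace X)" using emeasure_space[of m B] by simp
    then show ?thesis
      using fin(2)[OF openin_open_or_closed[OF openin_topspace]] by (rule order_le_less_trans)
  qed
  ultimately show "emeasure r B = 0"
    by (metis ennreal_add_left_cancel_le add.commute add_0_right infinity_ennreal_def less_irrefl le_zero_eq)
qed

section \<open>Integrals and the weak topology\<close>

text \<open>Both bounds on \<open>h\<close> are translates of \<open>g\<close> by \<open>e\<close>, and translation by \<open>e\<close> changes the integral of a
function with values in \<open>[0, M]\<close> by at most \<open>e * M\<close>.\<close>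

lemma integral_antimono_shift_close:
  fixes g h :: "real \<Rightarrow> real"
  assumes g: "antimono g" "\<And>t. 0 \<le> g t" "\<And>t. g t \<le> M" and h: "antimono h"
    and sandwich: "\<And>t. 0 \<le> t \<Longrightarrow> g (t + e) \<le> h t \<and> h t \<le> g (t - e)" and b: "0 \<le> b" and e: "0 \<le> e"
  shows "\<bar>integral {0..b} h - integral {0..b} g\<bar> \<le> e * M"
proof -
  have int: "f integrable_on {u..v}" if "antimono f" for f :: "real \<Rightarrow> real" and u v
  proof -
    have "(\<lambda>t. - f t) integrable_on {u..v}"
      using that by (intro integrable_on_mono_on) (auto simp: mono_on_def antimono_def)
    then show ?thesis using integrable_neg_iff by blast
  qed
  have shift: "((\<lambda>t. g (c + t)) has_integral integral {c..b+c} g) {0..b}" for c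
    using has_integral_shift_Icc_real[of g c "integral {c..b+c} g" 0 b] int[OF g(1)]
    by (simp add: comp_def has_integral_integral add.commute)
  have bound: "integral {u..v} g \<le> (v - u) * M" "0 \<le> integral {u..v} g" if "u \<le> v" for u v
  proof -
    have "integral {u..v} g \<le> integral {u..v} (\<lambda>_. M)" using g int by (intro integral_le) auto
    then show "integral {u..v} g \<le> (v - u) * M" using that by simp
    show "0 \<le> integral {u..v} g" using g int by (intro integral_nonneg) auto
  qed
  have "integral {0..b} h \<le> integral {-e..b-e} g"
    using has_integral_le[OF integrable_integral[OF int[OF h]] shift[of "-e"]] sandwich by (simp add: add.commute)
  also have "\<dots> \<le> integral {-e..b} g"
    using Henstock_Kurzweil_Integration.integral_combine[of "-e" "b-e" b g] int[OF g(1)] bound(2)[of "b-e" b] b e by simp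
  also have "\<dots> = integral {-e..0} g + integral {0..b} g"
    using Henstock_Kurzweil_Integration.integral_combine[of "-e" 0 b g] int[OF g(1)] b e by simp
  also have "\<dots> \<le> e * M + integral {0..b} g" using bound(1)[of "-e" 0] e by simp
  finally have upper: "integral {0..b} h \<le> e * M + integral {0..b} g" .
  have "integral {0..b} g \<le> integral {0..b+e} g"
    using Henstock_Kurzweil_Integration.integral_combine[of 0 b "b+e" g] int[OF g(1)] bound(2)[of b "b+e"] b e by simp
  also have "\<dots> = integral {0..e} g + integral {e..b+e} g"
    using Henstock_Kurzweil_Integration.integral_combine[of 0 e "b+e" g] int[OF g(1)] b e by simp
  also have "\<dots> \<le> e * M + integral {e..b+e} g" using bound(1)[of 0 e] e by simp
  also have "integral {e..b+e} g \<le> integral {0..b} h"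
    using has_integral_le[OF shift[of e] integrable_integral[OF int[OF h]]] sandwich by (simp add: add.commute)
  finally show ?thesis using upper by simp
qed

lemma openin_superlevel_set:
  assumes "f \<in> C0_nonneg X"
  shows "openin X {x \<in> topspace X. t < f x}"
proof -
  have "openin X {x \<in> topspace X. f x \<in> {t<..}}"
    using assms by (intro openin_continuous_map_preimage) (auto simp: C0_nonneg_def)
  then show ?thesis by simp
qed

lemma C0_nonneg_bounded:
  assumes "f \<in> C0_nonneg X"
  obtains b where "0 \<le> b" "f ` topspace X \<subseteq> {0..b}"
proof -
  have "compactin X {x \<in> topspace X. f x \<ge> 1}" "continuous_map X euclideanreal f"
    using assms by (auto simp: C0_nonneg_def)
  then have "compact (f ` {x \<in> topspace X. f x \<ge> 1})"
    using image_compactin by fastforce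
  then obtain B where B: "\<And>x. x \<in> topspace X \<Longrightarrow> 1 \<le> f x \<Longrightarrow> \<bar>f x\<bar> \<le> B"
    using compact_imp_bounded[THEN bounded_iff[THEN iffD1]] by fastforce
  have "f ` topspace X \<subseteq> {0..max 1 B}"
  proof clarify
    fix x assume x: "x \<in> topspace X"
    then have "0 \<le> f x" using assms by (auto simp: C0_nonneg_def)
    then show "f x \<in> {0..max 1 B}" using B[OF x] by (cases "1 \<le> f x") auto
  qed
  then show ?thesis by (rule that[rotated]) simp
qed

lemma dtm_integral_close:
  assumes \<nu>: "\<nu> \<in> DTM X" and \<nu>': "\<nu>' \<in> DTM X" and f: "f \<in> C0_nonneg X" and e: "0 \<le> e"
    and lower: "\<And>t. 0 \<le> t \<Longrightarrow> \<nu> {x \<in> topspace X. t + e < f x} \<le> \<nu>' {x \<in> topspace X. t < f x}"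
    and upper: "\<And>t. 0 \<le> t \<Longrightarrow> \<nu>' {x \<in> topspace X. t < f x} \<le> \<nu> {x \<in> topspace X. t - e < f x}"
  shows "\<bar>dtm_integral X \<nu>' f - dtm_integral X \<nu> f\<bar> \<le> e * enn2real (\<nu> (topspace X))"
proof (cases "topspace X = {}")
  case True
  then show ?thesis
    using DTM_empty[OF \<nu>] DTM_empty[OF \<nu>'] by (simp add: dtm_integral_def)
next
  case False
  obtain b where b: "0 \<le> b" "f ` topspace X \<subseteq> {0..b}" using C0_nonneg_bounded[OF f] .
  let ?L = "\<lambda>t. {x \<in> topspace X. t < f x}"
  have oc: "?L t \<in> open_or_closed_sets X" for t using openin_open_or_closed[OF openin_superlevel_set[OF f]] .
  have fin: "\<mu> (?L t) < top" if "\<mu> \<in> DTM X" for \<mu> t using DTM_finite[OF that oc] by simp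
  have anti: "antimono (\<lambda>t. enn2real (\<mu> (?L t)))" if \<mu>: "\<mu> \<in> DTM X" for \<mu>
  proof (rule antimonoI)
    fix s t :: real assume "s \<le> t"
    then have "?L t \<subseteq> ?L s" by auto
    then show "enn2real (\<mu> (?L t)) \<le> enn2real (\<mu> (?L s))"
      using fin[OF \<mu>] by (intro enn2real_mono DTM_mono[OF \<mu> oc oc])
  qed
  have "\<bar>integral {0..b} (\<lambda>t. enn2real (\<nu>' (?L t))) - integral {0..b} (\<lambda>t. enn2real (\<nu> (?L t)))\<bar>
      \<le> e * enn2real (\<nu> (topspace X))"
  proof (rule integral_antimono_shift_close[OF anti[OF \<nu>] _ _ anti[OF \<nu>'] _ b(1) e])
    show "enn2real (\<nu> (?L t)) \<le> enn2real (\<nu> (topspace X))" for t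
      using \<nu> DTM_mono[OF \<nu> oc openin_open_or_closed[OF openin_topspace]]
      by (intro enn2real_mono) (auto simp: DTM_def)
    show "enn2real (\<nu> (?L (t + e))) \<le> enn2real (\<nu>' (?L t)) \<and> enn2real (\<nu>' (?L t)) \<le> enn2real (\<nu> (?L (t - e)))"
      if "0 \<le> t" for t
      using lower[OF that] upper[OF that] fin[OF \<nu>] fin[OF \<nu>'] by (intro conjI enn2real_mono)
  qed simp
  then show ?thesis
    using dtm_integral_eq[OF \<nu> False b(2)] dtm_integral_eq[OF \<nu>' False b(2)] by simp
qed

text \<open>A subbasic weak neighbourhood constrains one integral, so finitely many integrals and one tolerance
control a basic neighbourhood.\<close>

lemma weak_topology_closure_ofI:
  assumes \<mu>: "\<mu> \<in> DTM X" and S: "S \<subseteq> DTM X"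
    and approx: "\<And>F e. finite F \<Longrightarrow> F \<subseteq> C0_nonneg X \<Longrightarrow> 0 < e \<Longrightarrow>
       \<exists>\<nu>\<in>S. \<forall>f\<in>F. \<bar>dtm_integral X \<nu> f - dtm_integral X \<mu> f\<bar> < e"
  shows "\<mu> \<in> weak_topology X closure_of S"
proof -
  let ?\<S> = "{{\<mu> \<in> DTM X. dtm_integral X \<mu> f \<in> V} | f V. f \<in> C0_nonneg X \<and> open V}"
  have nhd: "\<exists>F e. finite F \<and> F \<subseteq> C0_nonneg X \<and> 0 < e \<and>
      (\<forall>\<nu>\<in>DTM X. (\<forall>f\<in>F. \<bar>dtm_integral X \<nu> f - dtm_integral X \<mu> f\<bar> < e) \<longrightarrow> \<nu> \<in> T)"
    if "generate_topology_on ?\<S> T" "\<mu> \<in> T" for T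
    using that
  proof (induction T rule: generate_topology_on.induct)
    case Empty
    then show ?case by simp
  next
    case (Int a b)
    from Int.prems have "\<mu> \<in> a" "\<mu> \<in> b" by auto
    from Int.IH(1)[OF this(1)] obtain F e where
      F: "finite F" "F \<subseteq> C0_nonneg X" "0 < e" "\<forall>\<nu>\<in>DTM X. (\<forall>f\<in>F. \<bar>dtm_integral X \<nu> f - dtm_integral X \<mu> f\<bar> < e) \<longrightarrow> \<nu> \<in> a"
      by blast
    from Int.IH(2)[OF \<open>\<mu> \<in> b\<close>] obtain G d where
      G: "finite G" "G \<subseteq> C0_nonneg X" "0 < d" "\<forall>\<nu>\<in>DTM X. (\<forall>f\<in>G. \<bar>dtm_integral X \<nu> f - dtm_integral X \<mu> f\<bar> < d) \<longrightarrow> \<nu> \<in> b"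
      by blast
    show ?case using F G by (intro exI[of _ "F \<union> G"] exI[of _ "min e d"]) auto
  next
    case (UN K)
    then obtain k where k: "k \<in> K" "\<mu> \<in> k" by blast
    from UN.IH[OF this] k(1) show ?case by (meson UnionI)
  next
    case (Basis s)
    then obtain f V where f: "f \<in> C0_nonneg X" "open V" "s = {\<mu> \<in> DTM X. dtm_integral X \<mu> f \<in> V}" by blast
    then obtain e where e: "0 < e" "\<forall>y. dist y (dtm_integral X \<mu> f) < e \<longrightarrow> y \<in> V"
      using Basis.prems unfolding open_dist by blast
    then show ?case using f by (intro exI[of _ "{f}"] exI[of _ e]) (auto simp: dist_real_def)
  qed
  show ?thesis
    unfolding in_closure_of
  proof (intro conjI allI impI)
    show "\<mu> \<in> topspace (weak_topology X)" using \<mu> by (simp add: topspace_weak_topology)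
    fix T assume T: "\<mu> \<in> T \<and> openin (weak_topology X) T"
    then have "generate_topology_on ?\<S> T"
      unfolding weak_topology_def by (simp add: openin_topology_generated_by_iff)
    from nhd[OF this] T obtain F e where F: "finite F" "F \<subseteq> C0_nonneg X" "0 < e"
      "\<forall>\<nu>\<in>DTM X. (\<forall>f\<in>F. \<bar>dtm_integral X \<nu> f - dtm_integral X \<mu> f\<bar> < e) \<longrightarrow> \<nu> \<in> T" by blast
    from approx[OF F(1-3)] F(4) S show "\<exists>\<nu>. \<nu> \<in> S \<and> \<nu> \<in> T" by blast
  qed
qed

section \<open>Approximation by proper measures\<close>

text \<open>Functions vanishing at infinity exceed \<open>\<delta>\<close> only on a compact set, so finitely many connected open
sets of small oscillation are enough.\<close>

lemma finite_small_connected_cover: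
  assumes X: "locally_connected_space X" and F: "finite F" "F \<subseteq> C0_nonneg X" and \<delta>: "0 < \<delta>"
  obtains n :: nat and V :: "nat \<Rightarrow> 'a set" where
    "\<And>i. i < n \<Longrightarrow> openin X (V i) \<and> connectedin X (V i) \<and> V i \<noteq> {}"
    "\<And>i f x y. i < n \<Longrightarrow> f \<in> F \<Longrightarrow> x \<in> V i \<Longrightarrow> y \<in> V i \<Longrightarrow> \<bar>f x - f y\<bar> < \<delta>"
    "\<And>f x. f \<in> F \<Longrightarrow> x \<in> topspace X \<Longrightarrow> \<delta> \<le> f x \<Longrightarrow> \<exists>i<n. x \<in> V i"
proof -
  define K where "K = (\<Union>f\<in>F. {x \<in> topspace X. \<delta> \<le> f x})"
  have K: "compactin X K"
    unfolding K_def using F \<delta> by (intro compactin_Union) (auto simp: C0_nonneg_def)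
  have "\<exists>U. openin X U \<and> connectedin X U \<and> x \<in> U \<and> (\<forall>f\<in>F. \<forall>y\<in>U. \<bar>f y - f x\<bar> < \<delta> / 2)"
    if x: "x \<in> topspace X" for x
  proof -
    define W where "W = topspace X \<inter> (\<Inter>f\<in>F. {y \<in> topspace X. f y \<in> ball (f x) (\<delta>/2)})"
    have "openin X {y \<in> topspace X. f y \<in> ball (f x) (\<delta>/2)}" if "f \<in> F" for f
      using that F(2) by (intro openin_continuous_map_preimage) (auto simp: C0_nonneg_def)
    then have "openin X W"
      unfolding W_def using F(1) by (cases "F = {}") (auto intro!: openin_Int openin_INT2)
    moreover have "x \<in> W" using x \<delta> by (simp add: W_def)
    ultimately obtain U where U: "openin X U" "connectedin X U" "x \<in> U" "U \<subseteq> W"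
      by (rule locally_connected_spaceE[OF X])
    then have "\<forall>f\<in>F. \<forall>y\<in>U. \<bar>f y - f x\<bar> < \<delta> / 2"
      by (auto simp: W_def dist_real_def abs_minus_commute subset_iff)
    with U show ?thesis by blast
  qed
  then obtain U where U: "\<And>x. x \<in> topspace X \<Longrightarrow> openin X (U x) \<and> connectedin X (U x) \<and> x \<in> U x \<and>
      (\<forall>f\<in>F. \<forall>y\<in>U x. \<bar>f y - f x\<bar> < \<delta> / 2)" by metis
  have KX: "K \<subseteq> topspace X" using compactin_subset_topspace[OF K] .
  have "\<forall>V\<in>U ` K. openin X V" "K \<subseteq> \<Union>(U ` K)" using U KX by blast+
  then obtain \<F> where \<F>: "finite \<F>" "\<F> \<subseteq> U ` K" "K \<subseteq> \<Union>\<F>" using compactinD[OF K] by metis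
  obtain V where V: "bij_betw V {0..<card \<F>} \<F>" using ex_bij_betw_nat_finite[OF \<F>(1)] by blast
  have Vi: "\<exists>x\<in>topspace X. V i = U x" if "i < card \<F>" for i
    using bij_betwE[OF V] that \<F>(2) KX by (force simp: image_iff)
  show ?thesis
  proof (rule that[of "card \<F>" V])
    show "openin X (V i) \<and> connectedin X (V i) \<and> V i \<noteq> {}" if "i < card \<F>" for i
    proof -
      obtain x where "x \<in> topspace X" "V i = U x" using Vi[OF \<open>i < card \<F>\<close>] by blast
      then show ?thesis using U[of x] by auto
    qed
    show "\<bar>f x - f y\<bar> < \<delta>" if i: "i < card \<F>" and fxy: "f \<in> F" "x \<in> V i" "y \<in> V i" for i f x y
    proof -
      obtain z where "z \<in> topspace X" "V i = U z" using Vi[OF i] by blast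
      then have "\<bar>f x - f z\<bar> < \<delta>/2" "\<bar>f y - f z\<bar> < \<delta>/2" using U[of z] fxy by auto
      then show ?thesis by linarith
    qed
    show "\<exists>i<card \<F>. x \<in> V i" if "f \<in> F" "x \<in> topspace X" "\<delta> \<le> f x" for f x
    proof -
      have "x \<in> K" using that unfolding K_def by blast
      then obtain G where "G \<in> \<F>" "x \<in> G" using \<F>(3) by blast
      then show ?thesis using V unfolding bij_betw_def by (metis atLeastLessThan_iff imageE)
    qed
  qed
qed

text \<open>The measure \<open>m\<close> is discretised along the disjoint pieces of the cover by the \<open>V i\<close>: the mass of the
\<open>i\<close>-th piece is carried by \<open>\<kappa> i\<close>, which is concentrated in the connected set \<open>V i\<close>. This set may be larger
than the piece, so that masses move, but only inside the \<open>V i\<close>.\<close>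

lemma discretised_measure_sandwich:
  assumes m: "\<And>i. i < n \<Longrightarrow> V i \<in> sets m" and fin: "\<And>i. i < n \<Longrightarrow> emeasure m (disjointed V i) < \<infinity>"
    and \<kappa>1: "\<And>i W. i < n \<Longrightarrow> openin X W \<Longrightarrow> V i \<subseteq> W \<Longrightarrow> \<kappa> i W = 1"
    and \<kappa>0: "\<And>i W. i < n \<Longrightarrow> openin X W \<Longrightarrow> V i \<inter> W = {} \<Longrightarrow> \<kappa> i W = 0"
    and \<kappa>le: "\<And>i W. i < n \<Longrightarrow> openin X W \<Longrightarrow> \<kappa> i W \<le> (1::ennreal)"
    and W: "openin X W" and B: "B \<in> sets m"
  defines "\<xi>W \<equiv> (\<Sum>i\<in>{0..<n}. ennreal (measure m (disjointed V i)) * \<kappa> i W)"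
  shows "B \<subseteq> (\<Union>i\<in>{0..<n}. V i) \<Longrightarrow> (\<And>i. i < n \<Longrightarrow> V i \<inter> B \<noteq> {} \<Longrightarrow> V i \<subseteq> W) \<Longrightarrow> emeasure m B \<le> \<xi>W"
    and "(\<And>i. i < n \<Longrightarrow> V i \<inter> W \<noteq> {} \<Longrightarrow> V i \<subseteq> B) \<Longrightarrow> \<xi>W \<le> emeasure m B"
proof -
  let ?E = "disjointed V"
  have E: "?E i \<in> sets m" if "i < n" for i
    using m that unfolding disjointed_def by (intro sets.Diff sets.finite_UN) auto
  have eE: "ennreal (measure m (?E i)) = emeasure m (?E i)" if "i < n" for i
    using fin[OF that] by (simp add: emeasure_eq_ennreal_measure)
  have \<xi>: "\<xi>W = (\<Sum>i\<in>{0..<n}. emeasure m (?E i) * \<kappa> i W)" unfolding \<xi>W_def using eE by simp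
  show "emeasure m B \<le> \<xi>W"
    if cov: "B \<subseteq> (\<Union>i\<in>{0..<n}. V i)" and sub: "\<And>i. i < n \<Longrightarrow> V i \<inter> B \<noteq> {} \<Longrightarrow> V i \<subseteq> W"
  proof -
    let ?J = "{i \<in> {0..<n}. V i \<inter> B \<noteq> {}}"
    have "B \<subseteq> (\<Union>i\<in>{0..<n}. ?E i)" using cov by (simp add: finite_UN_disjointed_eq)
    then have "B \<subseteq> (\<Union>i\<in>?J. ?E i)" using disjointed_subset[of V] by blast
    then have "emeasure m B \<le> emeasure m (\<Union>i\<in>?J. ?E i)"
      using E by (intro emeasure_mono sets.finite_UN) auto
    also have "\<dots> \<le> (\<Sum>i\<in>?J. emeasure m (?E i))" using E by (intro emeasure_subadditive_finite) auto
    also have "\<dots> = (\<Sum>i\<in>?J. emeasure m (?E i) * \<kappa> i W)" using \<kappa>1 sub W by (intro sum.cong) auto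
    also have "\<dots> \<le> (\<Sum>i\<in>{0..<n}. emeasure m (?E i) * \<kappa> i W)" by (intro sum_mono2) auto
    finally show ?thesis by (simp add: \<xi>)
  qed
  show "\<xi>W \<le> emeasure m B" if sub: "\<And>i. i < n \<Longrightarrow> V i \<inter> W \<noteq> {} \<Longrightarrow> V i \<subseteq> B"
  proof -
    let ?J = "{i \<in> {0..<n}. V i \<inter> W \<noteq> {}}"
    have "\<xi>W = (\<Sum>i\<in>?J. emeasure m (?E i) * \<kappa> i W)"
      unfolding \<xi> using \<kappa>0[OF _ W] by (intro sum.mono_neutral_right) auto
    also have "\<dots> \<le> (\<Sum>i\<in>?J. emeasure m (?E i) * 1)" using \<kappa>le W by (intro sum_mono mult_left_mono) auto
    also have "\<dots> = emeasure m (\<Union>i\<in>?J. ?E i)"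
      using E disjoint_family_on_mono[OF subset_UNIV disjoint_family_disjointed]
      by (simp, intro sum_emeasure) auto
    also have "\<dots> \<le> emeasure m B"
      using sub disjointed_subset[of V] B by (intro emeasure_mono) fastforce+
    finally show ?thesis .
  qed
qed

text \<open>The greatest Radon measure \<open>m\<close> below \<open>\<nu>\<close> is replaced by its discretisation \<open>\<xi>\<close>. The masses move inside
sets on which every \<open>f\<close> in \<open>F\<close> oscillates by less than \<open>\<delta>\<close>, so the values at superlevel sets of \<open>f\<close> are
those of \<open>\<nu>\<close> up to a shift of the level by \<open>\<delta>\<close>.\<close>

lemma proper_approximation:
  fixes X :: "'a topology"
  assumes X: "\<nexists>x. topspace X = {x}" "connected_space X" "locally_connected_space X"
      "locally_compact_space X" "Hausdorff_space X" "\<nexists>x. cut_point X x"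
      "one_point_compactification_genus_zero X"
    and \<nu>: "\<nu> \<in> DTM X" and F: "finite F" "F \<subseteq> C0_nonneg X" and e: "0 < e"
  shows "\<exists>\<nu>'\<in>pDTM X. (\<nu> \<in> TM X \<longrightarrow> \<nu>' \<in> pTM X) \<and>
           (\<forall>f\<in>F. \<bar>dtm_integral X \<nu>' f - dtm_integral X \<nu> f\<bar> < e)"
proof -
  let ?oc = "open_or_closed_sets X"
  note Haus = X(5)
  obtain m where m: "radon_measure X m" and m_le: "\<And>A. A \<in> ?oc \<Longrightarrow> emeasure m A \<le> \<nu> A"
    and m_cover: "\<And>B e. B \<in> sets m \<Longrightarrow> 0 < e \<Longrightarrow>
       \<exists>U :: nat \<Rightarrow> 'a set. (\<forall>i. openin X (U i)) \<and> B \<subseteq> (\<Union>i. U i) \<and> (\<Sum>i. \<nu> (U i)) \<le> emeasure m B + ennreal e"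
    by (rule greatest_Radon_measure_below_DTM[OF Haus \<nu>]) (rule that)
  define M where "M = enn2real (\<nu> (topspace X))"
  (* The integrals will differ by at most \<delta> * M, which is below e even if M = 0. *)
  define \<delta> where "\<delta> = e / (M + 1)"
  have M: "0 \<le> M" by (simp add: M_def)
  then have \<delta>: "0 < \<delta>" "\<delta> * M < e" using e by (auto simp: \<delta>_def field_simps)
  obtain n V where V: "\<And>i. i < (n::nat) \<Longrightarrow> openin X (V i) \<and> connectedin X (V i) \<and> V i \<noteq> {}"
    and osc: "\<And>i f x y. i < n \<Longrightarrow> f \<in> F \<Longrightarrow> x \<in> V i \<Longrightarrow> y \<in> V i \<Longrightarrow> \<bar>f x - f y\<bar> < \<delta>"
    and cov: "\<And>f x. f \<in> F \<Longrightarrow> x \<in> topspace X \<Longrightarrow> \<delta> \<le> f x \<Longrightarrow> \<exists>i<n. x \<in> V i"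
    by (rule finite_small_connected_cover[OF X(3) F \<delta>(1)]) (rule that)
  define concentrated where "concentrated U \<mu> \<longleftrightarrow> \<mu> \<in> TM X \<and> (\<forall>x\<in>topspace X. \<exists>U. openin X U \<and> x \<in> U \<and> \<mu> U = 0) \<and>
    (\<forall>W. openin X W \<longrightarrow> (U \<subseteq> W \<longrightarrow> \<mu> W = 1) \<and> (U \<inter> W = {} \<longrightarrow> \<mu> W = 0))" for U \<mu>
  have "\<exists>\<mu>. concentrated (V i) \<mu>" if "i < n" for i
  proof -
    from V[OF that] have Vi: "openin X (V i)" "connectedin X (V i)" "V i \<noteq> {}" by auto
    show ?thesis
      using concentrated_locally_null_TM[OF X Vi] unfolding concentrated_def Bex_def .
  qed
  then obtain \<kappa> where conc: "\<And>i. i < n \<Longrightarrow> concentrated (V i) (\<kappa> i)" by metis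
  have \<kappa>: "\<kappa> i \<in> TM X" if "i < n" for i using conc[OF that] by (simp add: concentrated_def)
  have null: "\<exists>U. openin X U \<and> x \<in> U \<and> \<kappa> i U = 0" if "i < n" "x \<in> topspace X" for i x
    using conc[OF that(1)] that(2) by (simp add: concentrated_def)
  have \<kappa>1: "\<kappa> i W = 1" if "i < n" "openin X W" "V i \<subseteq> W" for i W
    using conc[OF that(1)] that(2,3) by (simp add: concentrated_def)
  have \<kappa>0: "\<kappa> i W = 0" if "i < n" "openin X W" "V i \<inter> W = {}" for i W
    using conc[OF that(1)] that(2,3) by (simp add: concentrated_def)
  have \<kappa>D: "\<kappa> i \<in> DTM X" if "i < n" for i using \<kappa>[OF that] TM_subset_DTM by blast
  have \<kappa>le: "\<kappa> i W \<le> 1" if "i < n" "openin X W" for i W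
  proof -
    have "\<kappa> i W \<le> \<kappa> i (topspace X)"
      using that openin_subset by (intro DTM_mono[OF \<kappa>D]) (auto intro: openin_open_or_closed)
    then show ?thesis using \<kappa>1[OF that(1) openin_topspace] V[OF that(1)] openin_subset by metis
  qed
  define c where "c i = measure m (disjointed V i)" for i
  define \<xi> where "\<xi> = restrict (\<lambda>A. \<Sum>i\<in>{0..<n}. ennreal (c i) * \<kappa> i A) ?oc"
  have \<xi>: "\<xi> \<in> TM X" unfolding \<xi>_def using \<kappa> by (intro TM_sum_scaled[OF Haus]) (auto simp: c_def)
  then have \<xi>D: "\<xi> \<in> DTM X" using TM_subset_DTM by blast
  have \<xi>_null: "\<exists>U. openin X U \<and> x \<in> U \<and> \<xi> U = 0" if x: "x \<in> topspace X" for x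
  proof -
    have "\<forall>i\<in>{..<n}. \<exists>U. openin X U \<and> x \<in> U \<and> \<kappa> i U = 0" using null x by simp
    from bchoice[OF this] obtain U where
      U: "\<And>i. i < n \<Longrightarrow> openin X (U i) \<and> x \<in> U i \<and> \<kappa> i (U i) = 0" by auto
    define W where "W = topspace X \<inter> (\<Inter>i\<in>{0..<n}. U i)"
    have W: "openin X W" unfolding W_def using U by (cases "n = 0") (auto intro!: openin_Int openin_INT2)
    have "\<kappa> i W = 0" if "i < n" for i
    proof -
      have "\<kappa> i W \<le> \<kappa> i (U i)"
        using that W U[OF that] unfolding W_def
        by (intro DTM_mono[OF \<kappa>D]) (auto intro: openin_open_or_closed)
      then show ?thesis using U[OF that] by simp
    qed
    then have "\<xi> W = 0" using openin_open_or_closed[OF W] by (simp add: \<xi>_def)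
    then show ?thesis using W U x unfolding W_def by auto
  qed
  define \<rho> where "\<rho> = restrict (\<lambda>A. \<nu> A - emeasure m A) ?oc"
  have \<rho>D: "\<rho> \<in> DTM X" unfolding \<rho>_def using DTM_diff_dominated_measure[OF Haus \<nu> m] m_le by blast
  have \<nu>_split: "\<nu> A = \<rho> A + emeasure m A" if "A \<in> ?oc" for A
    using that m_le[OF that] by (simp add: \<rho>_def diff_add_cancel_ennreal)
  define \<nu>' where "\<nu>' = restrict (\<lambda>A. \<rho> A + ennreal 1 * \<xi> A) ?oc"
  have \<nu>'D: "\<nu>' \<in> DTM X" unfolding \<nu>'_def by (rule DTM_add_scaled[OF Haus \<rho>D \<xi>D]) simp
  have \<nu>'_eq: "\<nu>' A = \<rho> A + \<xi> A" if "A \<in> ?oc" for A using that by (simp add: \<nu>'_def)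
  have proper: "proper_dtm X \<nu>'"
    using \<nu>'_eq by (intro proper_dtm_replace_greatest_Radon_measure[OF Haus \<nu> m m_le m_cover \<xi>D \<xi>_null])
      (auto simp: \<rho>_def)
  have TM: "\<nu>' \<in> TM X" if "\<nu> \<in> TM X"
  proof -
    have "\<rho> \<in> TM X" unfolding \<rho>_def using TM_diff_dominated_measure[OF Haus that m] m_le by blast
    then show ?thesis unfolding \<nu>'_def by (rule TM_add_scaled[OF Haus _ \<xi>]) simp
  qed
  have close: "\<bar>dtm_integral X \<nu>' f - dtm_integral X \<nu> f\<bar> < e" if f: "f \<in> F" for f
  proof -
    let ?L = "\<lambda>t. {x \<in> topspace X. t < f x}"
    have fC: "f \<in> C0_nonneg X" using f F(2) by blast
    have opL: "openin X (?L t)" for t using openin_superlevel_set[OF fC] .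
    have ocL: "?L t \<in> ?oc" for t using openin_open_or_closed[OF opL] .
    have setsL: "?L t \<in> sets m" for t using radon_measure_borel[OF m ocL] .
    have Vm: "V i \<in> sets m" if "i < n" for i
      using V[OF that] radon_measure_borel[OF m] openin_open_or_closed by blast
    have Efin: "emeasure m (disjointed V i) < \<infinity>" if "i < n" for i
    proof -
      have "emeasure m (disjointed V i) \<le> emeasure m (V i)"
        using Vm[OF that] by (intro emeasure_mono disjointed_subset)
      also have "\<dots> \<le> \<nu> (V i)" using m_le openin_open_or_closed V[OF that] by blast
      also have "\<dots> < \<infinity>" using DTM_finite[OF \<nu>] openin_open_or_closed V[OF that] by blast
      finally show ?thesis .
    qed
    note sandwich = discretised_measure_sandwich[of n V m X \<kappa>, OF Vm Efin \<kappa>1 \<kappa>0 \<kappa>le opL setsL]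
    have \<xi>L: "\<xi> (?L t) = (\<Sum>i\<in>{0..<n}. ennreal (measure m (disjointed V i)) * \<kappa> i (?L t))" for t
      using ocL by (simp add: \<xi>_def c_def)
    have shift: "V i \<subseteq> ?L s" if i: "i < n" and meet: "V i \<inter> ?L t \<noteq> {}" and st: "s \<le> t - \<delta>" for i s t
    proof
      fix y assume y: "y \<in> V i"
      obtain z where z: "z \<in> V i" "t < f z" using meet by blast
      have "\<bar>f z - f y\<bar> < \<delta>" using osc[OF i f z(1) y] .
      moreover have "y \<in> topspace X" using y V[OF i] openin_subset by blast
      ultimately show "y \<in> ?L s" using z(2) st by auto
    qed
    have mono\<rho>: "\<rho> (?L t) \<le> \<rho> (?L s)" if "s \<le> t" for s t
      using that by (intro DTM_mono[OF \<rho>D ocL ocL]) auto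
    have "\<bar>dtm_integral X \<nu>' f - dtm_integral X \<nu> f\<bar> \<le> \<delta> * enn2real (\<nu> (topspace X))"
    proof (rule dtm_integral_close[OF \<nu> \<nu>'D fC])
      fix t :: real assume t: "0 \<le> t"
      have "emeasure m (?L (t + \<delta>)) \<le> \<xi> (?L t)"
        unfolding \<xi>L
      proof (rule sandwich(1))
        show "?L (t + \<delta>) \<subseteq> (\<Union>i\<in>{0..<n}. V i)"
        proof
          fix x assume "x \<in> ?L (t + \<delta>)"
          then have "x \<in> topspace X" "\<delta> \<le> f x" using t by auto
          from cov[OF f this] show "x \<in> (\<Union>i\<in>{0..<n}. V i)" by auto
        qed
        show "V i \<subseteq> ?L t" if "i < n" "V i \<inter> ?L (t + \<delta>) \<noteq> {}" for i using shift[OF that] by simp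
      qed
      then show "\<nu> (?L (t + \<delta>)) \<le> \<nu>' (?L t)"
        unfolding \<nu>_split[OF ocL] \<nu>'_eq[OF ocL] using mono\<rho> \<delta>(1) by (intro add_mono) auto
      have "\<xi> (?L t) \<le> emeasure m (?L (t - \<delta>))"
        unfolding \<xi>L by (rule sandwich(2)) (use shift in auto)
      then show "\<nu>' (?L t) \<le> \<nu> (?L (t - \<delta>))"
        unfolding \<nu>_split[OF ocL] \<nu>'_eq[OF ocL] using mono\<rho> \<delta>(1) by (intro add_mono) auto
    qed (use \<delta>(1) in simp)
    then show ?thesis using \<delta>(2) by (simp add: M_def)
  qed
  show ?thesis
    using \<nu>'D proper TM close by (intro bexI[of _ \<nu>']) (auto simp: pDTM_def pTM_def)
qed

theorem theorem49:
  fixes X :: "'a topology"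
  assumes "\<nexists>x. topspace X = {x}"
    and "connected_space X"
    and "locally_connected_space X"
    and "locally_compact_space X"
    and "Hausdorff_space X"
    and "\<nexists>x. cut_point X x"
    and "one_point_compactification_genus_zero X"
  shows "TM X \<subseteq> weak_topology X closure_of pTM X \<and>
         DTM X \<subseteq> weak_topology X closure_of pDTM X"
proof (intro conjI subsetI)
  note approx = proper_approximation[OF assms]
  show "\<mu> \<in> weak_topology X closure_of pTM X" if \<mu>: "\<mu> \<in> TM X" for \<mu>
  proof (rule weak_topology_closure_ofI)
    show "\<mu> \<in> DTM X" using \<mu> TM_subset_DTM by blast
    show "pTM X \<subseteq> DTM X" unfolding pTM_def using TM_subset_DTM by blast
    show "\<exists>\<nu>\<in>pTM X. \<forall>f\<in>F. \<bar>dtm_integral X \<nu> f - dtm_integral X \<mu> f\<bar> < e"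
      if "finite F" "F \<subseteq> C0_nonneg X" "0 < e" for F and e :: real
      using approx[OF _ that, of \<mu>] \<mu> TM_subset_DTM by blast
  qed
  show "\<nu> \<in> weak_topology X closure_of pDTM X" if \<nu>: "\<nu> \<in> DTM X" for \<nu>
  proof (rule weak_topology_closure_ofI[OF \<nu>])
    show "pDTM X \<subseteq> DTM X" unfolding pDTM_def by blast
    show "\<exists>\<mu>\<in>pDTM X. \<forall>f\<in>F. \<bar>dtm_integral X \<mu> f - dtm_integral X \<nu> f\<bar> < e"
      if "finite F" "F \<subseteq> C0_nonneg X" "0 < e" for F and e :: real
      using approx[OF \<nu> that] by blast
  qed
qed

end
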